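(* Let $\Omega\subset\mathbb{R}^d$ be a nonempty set with the probability measure $\mu$. Assume that $\{u_i(x)\}_{i=1}^N$ is a real (or complex) orthonormal system in $L_2(\Omega,\mu)$ satisfying, with a constant $t>0$, the condition $$\sum_{i=1}^N |u_i(x)|^2\le N t^2\qquad\text{for all } x\in\Omega .$$ Then there is an absolute constant $C_1$ such that there exists a set $\{\xi^j\}_{j=1}^m\subset\Omega$ of $m\le C_1t^2N$ points with the property: for any $f=\sum_{i=1}^N c_iu_i$ we have $$C_2\|f\|_2^2\le \frac1m\sum_{j=1}^m|f(\xi^j)|^2\le C_3t^2\|f\|_2^2 ,$$ where $C_2$ and $C_3$ are absolute positive constants.
   Context: $\|f\|_2:=\left(\int_\Omega|f|^2\,d\mu\right)^{1/2}$. Elements of $L_2(\Omega,\mu)$ are understood as specific functions, not equivalence classes, and each function in the span of $u_1,\dots,u_N$ is assumed to be defined at every point $x\in\Omega$. The coefficients $c_i$ are real in the real case and complex in the complex case. "Absolute" means that the constants $C_1,C_2,C_3$ do not depend on $d,\Omega,\mu,N,t$ or the system $\{u_i\}$. *)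

theory Defs
  imports "HOL-Probability.Probability"
begin

(* Points of R^d are functions on the index set {1..d} (undefined elsewhere), because absolute
   constants have to be chosen before d; with the type real ^ 'd they could depend on d. *)
definition euclidean_points :: "nat \<Rightarrow> (nat \<Rightarrow> real) set" where
  "euclidean_points d = {1..d} \<rightarrow>\<^sub>E UNIV"

(* Elements of L_2 are functions, not equivalence classes. *)
definition square_integrable :: "'x measure \<Rightarrow> ('x \<Rightarrow> 'k::real_normed_field) \<Rightarrow> bool" where
  "square_integrable M f \<longleftrightarrow>
     f \<in> borel_measurable M \<and> integrable M (\<lambda>x. (norm (f x))\<^sup>2)"

definition norm_L2 :: "'x measure \<Rightarrow> ('x \<Rightarrow> 'k::real_normed_field) \<Rightarrow> real" where
  "norm_L2 M f = sqrt (\<integral>x. (norm (f x))\<^sup>2 \<partial>M)"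

definition orthonormal_real :: "'x measure \<Rightarrow> nat \<Rightarrow> (nat \<Rightarrow> 'x \<Rightarrow> real) \<Rightarrow> bool" where
  "orthonormal_real M N u \<longleftrightarrow>
     (\<forall>i\<in>{1..N}. square_integrable M (u i)) \<and>
     (\<forall>i\<in>{1..N}. \<forall>j\<in>{1..N}. (\<integral>x. u i x * u j x \<partial>M) = (if i = j then 1 else 0))"

definition orthonormal_complex :: "'x measure \<Rightarrow> nat \<Rightarrow> (nat \<Rightarrow> 'x \<Rightarrow> complex) \<Rightarrow> bool" where
  "orthonormal_complex M N u \<longleftrightarrow>
     (\<forall>i\<in>{1..N}. square_integrable M (u i)) \<and>
     (\<forall>i\<in>{1..N}. \<forall>j\<in>{1..N}. (\<integral>x. u i x * cnj (u j x) \<partial>M) = (if i = j then 1 else 0))"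

definition lin_comb :: "nat \<Rightarrow> (nat \<Rightarrow> 'x \<Rightarrow> 'k::real_normed_field) \<Rightarrow> (nat \<Rightarrow> 'k) \<Rightarrow> 'x \<Rightarrow> 'k" where
  "lin_comb N u c x = (\<Sum>i=1..N. c i * u i x)"

(* The points xi 1, ..., xi m need not be distinct: with distinct points a discretization of this
   size can fail to exist when the measure has atoms. *)
definition discretizes_L2 ::
  "real \<Rightarrow> real \<Rightarrow> 'x measure \<Rightarrow> nat \<Rightarrow> (nat \<Rightarrow> 'x \<Rightarrow> 'k::real_normed_field) \<Rightarrow> nat \<Rightarrow> (nat \<Rightarrow> 'x) \<Rightarrow> bool"
where
  "discretizes_L2 A B M N u m \<xi> \<longleftrightarrow>
     (\<forall>c :: nat \<Rightarrow> 'k.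
        A * (norm_L2 M (lin_comb N u c))\<^sup>2
          \<le> (1 / real m) * (\<Sum>j=1..m. (norm (lin_comb N u c (\<xi> j)))\<^sup>2) \<and>
        (1 / real m) * (\<Sum>j=1..m. (norm (lin_comb N u c (\<xi> j)))\<^sup>2)
          \<le> B * (norm_L2 M (lin_comb N u c))\<^sup>2)"

end

theory Submission
  imports Defs "HOL-Computational_Algebra.Fundamental_Theorem_Algebra" "Jordan_Normal_Form.Determinant"
begin

text \<open>
  The proof follows Marcus, Spielman and Srivastava. A greedy choice of many points makes the
  empirical mean of the squared moduli comparable with the squared norm. The point set is then halved
  repeatedly, each time with almost no loss, until about \<^term>\<open>N * t\<^sup>2\<close> points are left.

  A halving amounts to choosing signs for rank one positive semidefinite matrices. With
  \<open>D(y) = det (\<Sum> y\<^sub>j v\<^sub>j\<^sup>* v\<^sub>j)\<close>, the product \<open>D(z) D(w)\<close> is multiaffine and stable; moving \<open>j\<close> to one of the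
  two halves translates \<open>z\<^sub>j\<close> or \<open>w\<^sub>j\<close> by \<open>-2\<close>, and the average over both choices applies
  \<open>1 - \<partial>/\<partial>z\<^sub>j - \<partial>/\<partial>w\<^sub>j\<close>. The barrier argument bounds the largest diagonal root of the
  polynomial averaged over all \<open>j\<close>, and real-rootedness of all convex combinations of the two
  choices shows that one of them does not increase this root.
  Since all polynomials stay multiaffine, the analytic input reduces to the Rayleigh inequality
  \<open>p \<cdot> \<partial>\<^sub>i\<partial>\<^sub>j p \<le> \<partial>\<^sub>i p \<cdot> \<partial>\<^sub>j p\<close> on real points.
\<close>

subsection \<open>Multiaffine stable polynomials\<close>

text \<open>The obstacle is the number of points: the greedy sample takes about N^4 (N t^2 + 1)^2 of
  them, and only halvings whose losses add up to a constant can bring this down to order N t^2. Both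
  halves are bounded from above at once, hence the product of two determinants: a lower bound for
  one half is the total minus the upper bound for the other. A halving is governed by the largest
  ratio \<epsilon> of one summand to the total form and costs a factor 1 + O(sqrt \<epsilon>). Here
  \<epsilon> is of order N t^2 / T, where T is the nominal number of points, so the cost grows by
  sqrt 2 per halving and the last ones dominate. Stopping with T between 32400 N t^2 and 64800 N t^2
  keeps the total error at most 1/4, and C1 = 64800. The forms are normalized by T, while the claim
  divides by the true number m. From m <= T comes C2 = 1/4. Conversely, comparing traces gives T <=
  4 t^2 m; this is where the factor t^2 of the upper bound enters, with C3 = 2 * 4.\<close>

text \<open>If \<open>c\<close> encodes a multiaffine polynomial, then \<open>dcoeff i c\<close> encodes its partial derivative in the
  variable \<open>i\<close>.\<close>

definition maff :: "'i set \<Rightarrow> ('i set \<Rightarrow> real) \<Rightarrow> ('i \<Rightarrow> 'a) \<Rightarrow> 'a::{real_algebra_1, comm_ring_1}" where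
  "maff I c y = (\<Sum>S\<in>Pow I. of_real (c S) * (\<Prod>i\<in>S. y i))"

definition dcoeff :: "'i \<Rightarrow> ('i set \<Rightarrow> real) \<Rightarrow> 'i set \<Rightarrow> real" where
  "dcoeff i c S = (if i \<in> S then 0 else c (insert i S))"

lemma maff_cong: "(\<And>i. i \<in> I \<Longrightarrow> y i = y' i) \<Longrightarrow> maff I c y = maff I c y'"
  unfolding maff_def by (intro sum.cong prod.cong arg_cong2[where f="(*)"]) auto

lemma maff_linear:
  "maff I (\<lambda>S. r * c S + s * c' S) y = of_real r * maff I c y + of_real s * maff I c' y"
  unfolding maff_def by (simp add: sum_distrib_left sum.distrib[symmetric] algebra_simps)

lemma of_real_maff: "of_real (maff I c y) = maff I c (\<lambda>i. of_real (y i))"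
  unfolding maff_def by simp

lemma cnj_maff: "cnj (maff I c y) = maff I c (\<lambda>i. cnj (y i))"
  unfolding maff_def by simp

lemma sum_Pow_split:
  fixes g :: "'i set \<Rightarrow> 'b::comm_monoid_add"
  assumes "finite I" "i \<in> I"
  shows "(\<Sum>S\<in>Pow I. g S) = (\<Sum>S\<in>Pow (I - {i}). g S + g (insert i S))"
proof -
  have "Pow I = Pow (I - {i}) \<union> insert i ` Pow (I - {i})"
    using assms(2) by (metis Pow_insert insert_Diff)
  then have "(\<Sum>S\<in>Pow I. g S) = (\<Sum>S\<in>Pow (I - {i}). g S) + (\<Sum>S\<in>insert i ` Pow (I - {i}). g S)"
    using assms by (simp only:) (rule sum.union_disjoint; auto)
  also have "(\<Sum>S\<in>insert i ` Pow (I - {i}). g S) = (\<Sum>S\<in>Pow (I - {i}). g (insert i S))"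
    by (subst sum.reindex) (auto simp: inj_on_def)
  finally show ?thesis by (simp add: sum.distrib)
qed

text \<open>Each variable occurs to the first power only, so the Taylor expansion in it is exact
  after the linear term. This identity replaces differential calculus below, for real and for
  complex arguments.\<close>

lemma maff_upd:
  fixes y :: "'i \<Rightarrow> 'a::{real_algebra_1, comm_ring_1}"
  assumes "finite I" "i \<in> I"
  shows "maff I c (y(i := y i + h)) = maff I c y + h * maff I (dcoeff i c) y"
proof -
  have ex: "maff I c z = (\<Sum>S\<in>Pow (I - {i}). of_real (c S) * prod z S
      + of_real (c (insert i S)) * (z i * prod z S))" for z :: "'i \<Rightarrow> 'a"
    unfolding maff_def sum_Pow_split[OF assms] using assms
    by (intro sum.cong) (auto simp: prod.insert_if finite_subset[of _ "I - {i}"])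
  have ex': "maff I (dcoeff i c) y = (\<Sum>S\<in>Pow (I - {i}). of_real (c (insert i S)) * prod y S)"
    unfolding maff_def sum_Pow_split[OF assms] by (intro sum.cong) (auto simp: dcoeff_def)
  have "prod (y(i := y i + h)) S = prod y S" if "S \<in> Pow (I - {i})" for S
    using that by (intro prod.cong) auto
  then show ?thesis
    unfolding ex ex' sum_distrib_left sum.distrib[symmetric]
    by (intro sum.cong) (auto simp: algebra_simps)
qed

lemma dcoeff_commute: "dcoeff i (dcoeff j c) = dcoeff j (dcoeff i c)"
  by (auto simp: dcoeff_def fun_eq_iff insert_commute)

lemma dcoeff_dcoeff_same: "dcoeff i (dcoeff i c) = (\<lambda>_. 0)"
  by (auto simp: dcoeff_def fun_eq_iff)

lemma maff_0 [simp]: "maff I (\<lambda>_. 0) y = 0"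
  by (simp add: maff_def)

lemma dcoeff_linear: "dcoeff i (\<lambda>S. r * c S + s * c' S) = (\<lambda>S. r * dcoeff i c S + s * dcoeff i c' S)"
  by (auto simp: dcoeff_def fun_eq_iff)

lemma dcoeff_0 [simp]: "dcoeff i (\<lambda>_. 0) = (\<lambda>_. 0)"
  by (simp add: dcoeff_def fun_eq_iff)

lemma continuous_on_maff [continuous_intros]:
  fixes g :: "'b::topological_space \<Rightarrow> 'i \<Rightarrow> 'a::{real_normed_algebra_1, comm_ring_1}"
  assumes "\<And>i. i \<in> I \<Longrightarrow> continuous_on X (\<lambda>t. g t i)"
  shows "continuous_on X (\<lambda>t. maff I c (g t))"
  unfolding maff_def
proof (intro continuous_on_sum continuous_on_mult continuous_on_const)
  fix S assume "S \<in> Pow I"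
  show "continuous_on X (\<lambda>x. prod (g x) S)"
  proof (cases "finite S")
    case True
    then show ?thesis using \<open>S \<in> Pow I\<close>
      by (induction S) (auto intro!: continuous_on_mult assms)
  qed simp
qed

section \<open>Real stability and the Rayleigh inequality\<close>

definition hstable :: "'i set \<Rightarrow> ('i set \<Rightarrow> real) \<Rightarrow> bool" where
  "hstable I c \<longleftrightarrow> (\<forall>y::'i \<Rightarrow> complex. (\<forall>i\<in>I. 0 < Im (y i)) \<longrightarrow> maff I c y \<noteq> 0)"

text \<open>As a function of variable \<open>i\<close> alone the polynomial is affine, and its zero
  must not lie in the upper half plane. Clearing the denominator gives a form that also covers a
  vanishing derivative.\<close>

lemma hstable_Im:
  assumes "finite I" "hstable I c" "i \<in> I" "\<And>k. k \<in> I \<Longrightarrow> 0 < Im (y k)"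
  shows "Im (maff I (dcoeff i c) y * cnj (maff I c y)) \<le> - Im (y i) * (cmod (maff I (dcoeff i c) y))\<^sup>2"
proof (cases "maff I (dcoeff i c) y = 0")
  case False
  define a where "a = maff I c y"
  define b where "b = maff I (dcoeff i c) y"
  have b: "b \<noteq> 0" using False by (simp add: b_def)
  have "maff I c (y(i := y i + - a / b)) = 0"
    using b unfolding maff_upd[OF assms(1,3)] a_def b_def by simp
  then have "\<not> (\<forall>k\<in>I. 0 < Im ((y(i := y i + - a / b)) k))"
    using assms(2) unfolding hstable_def by blast
  then have "Im (y i + - a / b) \<le> 0"
    using assms(3,4) by (auto split: if_splits)
  moreover have "Im (- a / b) = Im (b * cnj a) / (cmod b)\<^sup>2"
    unfolding complex_div_cnj[of "- a" b]
    by (simp add: diff_divide_distrib mult.commute flip: of_real_power)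
  ultimately have "Im (b * cnj a) / (cmod b)\<^sup>2 \<le> - Im (y i)"
    by simp
  then show ?thesis
    unfolding a_def[symmetric] b_def[symmetric] using b by (simp add: pos_divide_le_eq)
qed simp

text \<open>At a zero in the upper half planes the polynomial equals a nonnegative combination of
  two of its derivatives. After multiplication by its conjugate the left side is real, while both
  terms on the right have nonpositive imaginary part by \<open>hstable_Im\<close>; so both vanish,
  and the polynomial with them. General weights are needed for convex combinations of two
  translations.\<close>

lemma hstable_mix:
  assumes "finite I" "hstable I c" "i \<in> I" "j \<in> I" "0 \<le> r" "0 \<le> s"
  shows "hstable I (\<lambda>S. c S - r * dcoeff i c S - s * dcoeff j c S)"
  unfolding hstable_def
proof (intro allI impI notI)
  fix y :: "'a \<Rightarrow> complex" assume y: "\<forall>i\<in>I. 0 < Im (y i)"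
  assume 0: "maff I (\<lambda>S. c S - r * dcoeff i c S - s * dcoeff j c S) y = 0"
  define a where "a = maff I c y"
  define b where "b = maff I (dcoeff i c) y"
  define d where "d = maff I (dcoeff j c) y"
  have "maff I (\<lambda>S. c S - r * dcoeff i c S - s * dcoeff j c S) y = a - of_real r * b - of_real s * d"
    using maff_linear[of I 1 "\<lambda>S. 1 * c S + (-r) * dcoeff i c S" "-s" "dcoeff j c" y]
      maff_linear[of I 1 c "-r" "dcoeff i c" y] by (simp add: a_def b_def d_def)
  with 0 have a: "a = of_real r * b + of_real s * d" by (simp add: algebra_simps)
  have "0 = Im (a * cnj a)" by simp
  also have "\<dots> = r * Im (b * cnj a) + s * Im (d * cnj a)"
    by (subst (1) a) (simp add: algebra_simps)
  also have "\<dots> \<le> r * (- Im (y i) * (cmod b)\<^sup>2) + s * (- Im (y j) * (cmod d)\<^sup>2)"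
    unfolding a_def b_def d_def using assms y
    by (intro add_mono mult_left_mono hstable_Im) auto
  finally have le: "r * (Im (y i) * (cmod b)\<^sup>2) + s * (Im (y j) * (cmod d)\<^sup>2) \<le> 0" by simp
  have "0 \<le> r * (Im (y i) * (cmod b)\<^sup>2)" "0 \<le> s * (Im (y j) * (cmod d)\<^sup>2)"
    using assms y by (simp_all add: less_imp_le)
  with le have "r * (Im (y i) * (cmod b)\<^sup>2) = 0" "s * (Im (y j) * (cmod d)\<^sup>2) = 0"
    by linarith+
  then have "of_real r * b = 0" "of_real s * d = 0"
    using y assms by force+
  then have "a = 0" using a by (simp only: add_0)
  then show False using assms(2) y by (auto simp: hstable_def a_def)
qed

definition translate :: "'i \<Rightarrow> real \<Rightarrow> ('i set \<Rightarrow> real) \<Rightarrow> 'i set \<Rightarrow> real" where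
  "translate i r c S = c S + r * dcoeff i c S"

lemma maff_translate:
  assumes "finite I" "i \<in> I"
  shows "maff I (translate i r c) y = maff I c (y(i := y i + of_real r))"
  using maff_linear[of I 1 c r "dcoeff i c" y] maff_upd[OF assms, of c y "of_real r"]
  by (simp add: translate_def[abs_def])

lemma hstable_translate:
  assumes "finite I" "i \<in> I" "hstable I c"
  shows "hstable I (translate i r c)"
  using assms(3) unfolding hstable_def maff_translate[OF assms(1,2)] by simp

text \<open>\<open>hstable_Im\<close> for variable \<open>j\<close>, taken in the limit where only
  coordinate \<open>i\<close> keeps an imaginary part, equal to 1. There multiaffinity makes the
  real and imaginary parts of each polynomial its value and its \<open>i\<close>-th derivative at
  \<open>y\<close>, and the limit inequality is the claim.\<close>

lemma rayleigh:
  fixes y :: "'i \<Rightarrow> real"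
  assumes "finite I" "hstable I c" "i \<in> I" "j \<in> I"
  shows "maff I c y * maff I (dcoeff i (dcoeff j c)) y \<le> maff I (dcoeff i c) y * maff I (dcoeff j c) y"
proof -
  \<comment> \<open>A positive \<theta> keeps all coordinates in the open half plane; \<theta> = 0
    leaves an imaginary part in coordinate \<open>i\<close> only.\<close>
  define z where "z \<theta> k = complex_of_real (y k) + \<i> * complex_of_real ((if k = i then 1 else 0) + \<theta>)"
    for \<theta> k
  define g where "g \<theta> = Im (maff I (dcoeff j c) (z \<theta>) * cnj (maff I c (z \<theta>)))" for \<theta>
  have "g \<theta> \<le> 0" if "0 < \<theta>" for \<theta>
  proof -
    have "g \<theta> \<le> - Im (z \<theta> j) * (cmod (maff I (dcoeff j c) (z \<theta>)))\<^sup>2"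
      unfolding g_def using that assms by (intro hstable_Im) (auto simp: z_def)
    also have "\<dots> \<le> 0" using that by (auto simp: z_def intro!: mult_nonpos_nonneg)
    finally show ?thesis .
  qed
  moreover have "continuous_on UNIV g"
    unfolding g_def z_def
    by (intro continuous_intros)
  ultimately have g0: "g 0 \<le> 0"
  proof -
    have "(g \<longlongrightarrow> g 0) (at_right 0)"
      using \<open>continuous_on UNIV g\<close>
      by (metis UNIV_I continuous_on_def filterlim_at_split)
    moreover have "eventually (\<lambda>\<theta>. g \<theta> \<le> 0) (at_right 0)"
      using \<open>\<And>\<theta>. 0 < \<theta> \<Longrightarrow> g \<theta> \<le> 0\<close> by (auto simp: eventually_at_right_less eventually_at_filter)
    ultimately show ?thesis by (intro tendsto_upperbound[of g "g 0" "at_right 0"]) auto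
  qed
  define w where "w k = complex_of_real (y k)" for k
  have z0: "z 0 = w(i := w i + \<i>)" by (auto simp: z_def w_def)
  have e: "maff I f (z 0) = of_real (maff I f y) + \<i> * of_real (maff I (dcoeff i f) y)" for f
    unfolding z0 maff_upd[OF assms(1,3)] unfolding of_real_maff w_def ..
  have "g 0 = maff I c y * maff I (dcoeff i (dcoeff j c)) y - maff I (dcoeff i c) y * maff I (dcoeff j c) y"
    unfolding g_def e by (simp add: algebra_simps)
  with g0 show ?thesis by simp
qed

subsection \<open>The barrier argument\<close>

text \<open>The relation "above the roots" of the barrier method, with the sign fixed as positive so
  that averages of such polynomials can be compared.\<close>

definition above :: "'i set \<Rightarrow> ('i set \<Rightarrow> real) \<Rightarrow> ('i \<Rightarrow> real) \<Rightarrow> bool" where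
  "above I c y \<longleftrightarrow> (\<forall>s. (\<forall>i\<in>I. y i \<le> s i) \<longrightarrow> 0 < maff I c s)"

text \<open>The logarithmic partial derivative in variable \<open>i\<close>.\<close>

definition barrier :: "'i set \<Rightarrow> ('i set \<Rightarrow> real) \<Rightarrow> 'i \<Rightarrow> ('i \<Rightarrow> real) \<Rightarrow> real" where
  "barrier I c i y = maff I (dcoeff i c) y / maff I c y"

text \<open>The derivative of the barrier in direction \<open>k\<close> has the Rayleigh difference
  as numerator. In a multiaffine polynomial the finite difference has the same numerator up to the
  step length, so coordinates are raised one at a time; \<open>K\<close> is the set of those already
  raised.\<close>

lemma barrier_antimono:
  assumes fin: "finite I" and st: "hstable I c" and ab: "above I c y" and i: "i \<in> I"
    and le: "\<And>k. k \<in> I \<Longrightarrow> y k \<le> y' k"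
  shows "barrier I c i y' \<le> barrier I c i y"
proof -
  have "barrier I c i (\<lambda>k. if k \<in> K then y' k else y k) \<le> barrier I c i y" if "finite K" "K \<subseteq> I" for K
    using that
  proof (induction K)
    case (insert k K)
    define z where "z = (\<lambda>k. if k \<in> K then y' k else y k)"
    define h where "h = y' k - y k"
    have h: "0 \<le> h" using le insert.prems by (auto simp: h_def)
    have k: "k \<in> I" using insert.prems by auto
    have zk: "z k = y k" using insert.hyps by (simp add: z_def)
    have eq: "(\<lambda>l. if l \<in> insert k K then y' l else y l) = z(k := z k + h)"
      using insert.hyps by (auto simp: z_def h_def fun_eq_iff)
    have p0: "0 < maff I c z"
      using ab le insert.prems unfolding above_def by (auto simp: z_def)
    have p1: "0 < maff I c (z(k := z k + h))"
      using ab le insert.prems unfolding above_def eq[symmetric] by auto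
    have "h * (maff I c z * maff I (dcoeff k (dcoeff i c)) z) \<le> h * (maff I (dcoeff k c) z * maff I (dcoeff i c) z)"
      by (intro mult_left_mono rayleigh fin st k i h)
    then have "barrier I c i (z(k := z k + h)) \<le> barrier I c i z"
      using p0 p1 unfolding barrier_def maff_upd[OF fin k]
      by (simp add: divide_simps algebra_simps)
    then show ?case
      unfolding eq using insert by (simp add: z_def)
  qed simp
  from this[OF fin subset_refl] show ?thesis
    unfolding barrier_def using maff_cong[of I "\<lambda>k. if k \<in> I then y' k else y k" y']
    by simp
qed

text \<open>The tangent at \<open>0\<close> of the ratio of two quadratics lies below its value at \<open>-D\<close>. No derivatives
  are needed: the difference is an explicit rational function, and its sign is read off at the
  root of the denominator that is nearest to \<open>-D\<close>.\<close>

lemma quadratic_ratio_convex: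
  fixes a0 a1 a2 b0 b1 b2 D :: real
  assumes D: "0 \<le> D"
    and pos: "\<And>x. - D \<le> x \<Longrightarrow> 0 < a0 + a1 * x + a2 * x\<^sup>2"
    and disc: "4 * a0 * a2 \<le> a1\<^sup>2"
    and wr: "\<And>x. (b1 + 2 * b2 * x) * (a0 + a1 * x + a2 * x\<^sup>2) \<le> (b0 + b1 * x + b2 * x\<^sup>2) * (a1 + 2 * a2 * x)"
  shows "b0 / a0 + D * (b0 * a1 - b1 * a0) / a0\<^sup>2
    \<le> (b0 - b1 * D + b2 * D\<^sup>2) / (a0 - a1 * D + a2 * D\<^sup>2)"
proof -
  have a0: "0 < a0" using pos[of 0] D by simp
  have aD: "0 < a0 - a1 * D + a2 * D\<^sup>2" using pos[of "-D"] by simp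
  have m10: "b1 * a0 - b0 * a1 \<le> 0" using wr[of 0] by simp
  \<comment> \<open>With negative \<open>a2\<close> the denominator could not stay positive far to
    the right.\<close>
  have a2: "0 \<le> a2"
  proof (rule ccontr)
    assume "\<not> 0 \<le> a2"
    then have n: "a2 < 0" by simp
    define x where "x = (\<bar>a1\<bar> + a0) / (- a2) + 1"
    have "0 \<le> (\<bar>a1\<bar> + a0) / (- a2)" using n a0 by (intro divide_nonneg_pos) auto
    then have x1: "1 \<le> x" by (simp only: x_def)
    have "- a2 * x \<ge> \<bar>a1\<bar> + a0" using n by (simp add: x_def field_simps)
    then have "- a2 * x * x \<ge> (\<bar>a1\<bar> + a0) * x"
      using x1 by (intro mult_right_mono) auto
    moreover have "a0 * 1 \<le> a0 * x" "a1 * x \<le> \<bar>a1\<bar> * x"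
      using x1 a0 by (auto intro!: mult_left_mono mult_right_mono)
    ultimately have "a0 + a1 * x + a2 * x\<^sup>2 \<le> 0"
      by (simp add: power2_eq_square algebra_simps)
    with pos[of x] x1 D show False by simp
  qed
  \<comment> \<open>Up to the nonnegative factor D^2 / (a0^2 * denominator at -D), \<open>Q\<close>
    is the difference of the two sides, so only its sign matters.\<close>
  define Q where "Q = a0 * (b2 * a0 - b0 * a2) - a1 * (b1 * a0 - b0 * a1) + D * a2 * (b1 * a0 - b0 * a1)"
  have Q: "0 \<le> Q"
  proof (cases "a2 = 0")
    case True
    show ?thesis
    proof (cases "a1 = 0")
      case True
      have "b2 = 0"
      proof (rule ccontr)
        assume n: "b2 \<noteq> 0"
        \<comment> \<open>The point is chosen so that b1 + 2 * b2 * x = 1.\<close>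
        have "(b1 + 2 * b2 * ((1 - b1) / (2 * b2))) * a0 \<le> 0"
          using wr[of "(1 - b1) / (2 * b2)"] True \<open>a2 = 0\<close> by simp
        then show False using n a0 by simp
      qed
      then show ?thesis using True \<open>a2 = 0\<close> by (simp add: Q_def)
    next
      case False
      have "a1 > 0"
      proof (rule ccontr)
        assume "\<not> a1 > 0"
        then have n: "a1 < 0" using False by simp
        then have "0 \<le> - a0 / a1" using a0 by (simp add: divide_nonneg_neg le_divide_eq)
        then have "0 < a0 + a1 * (- a0 / a1)" using pos[of "- a0 / a1"] D True by simp
        then show False using n by simp
      qed
      have "(b0 + b1 * (- a0 / a1) + b2 * (- a0 / a1)\<^sup>2) * a1 \<ge> 0"
        using wr[of "- a0 / a1"] True \<open>a1 > 0\<close> by simp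
      then have "0 \<le> a1 * ((b0 + b1 * (- a0 / a1) + b2 * (- a0 / a1)\<^sup>2) * a1)"
        using \<open>a1 > 0\<close> by simp
      also have "\<dots> = Q"
        using \<open>a1 > 0\<close> True by (simp add: Q_def field_simps power2_eq_square)
      finally show ?thesis .
    qed
  next
    case False
    with a2 have a2: "0 < a2" by simp
    define q where "q = sqrt (a1\<^sup>2 - 4 * a0 * a2)"
    have q: "q\<^sup>2 = a1\<^sup>2 - 4 * a0 * a2" "0 \<le> q" using disc by (auto simp: q_def)
    \<comment> \<open>The denominator is a2 * (x + \<alpha>) * (x + \<beta>), and -\<alpha> is its
      root nearest to -D.\<close>
    define \<alpha> where "\<alpha> = (a1 - q) / (2 * a2)"
    define \<beta> where "\<beta> = (a1 + q) / (2 * a2)"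
    have a1_eq: "a1 = a2 * (\<alpha> + \<beta>)" using a2 by (simp add: \<alpha>_def \<beta>_def field_simps)
    have "4 * a2 * (a2 * \<alpha> * \<beta>) = a1\<^sup>2 - q\<^sup>2"
      using a2 by (simp add: \<alpha>_def \<beta>_def power2_eq_square) (simp add: field_simps)
    then have a0_eq: "a0 = a2 * \<alpha> * \<beta>" using q a2 by simp
    have le: "\<alpha> \<le> \<beta>" using q a2 by (simp add: \<alpha>_def \<beta>_def divide_right_mono)
    have "D < \<alpha>"
    proof (rule ccontr)
      assume "\<not> D < \<alpha>"
      then have "0 < a0 + a1 * (- \<alpha>) + a2 * (- \<alpha>)\<^sup>2" by (intro pos) simp
      then show False unfolding a0_eq a1_eq by (simp add: power2_eq_square algebra_simps)
    qed
    then have ab: "0 < \<alpha>" "0 < \<beta>" using D le by auto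
    \<comment> \<open>The numerator at -\<alpha>. At a simple root \<open>wr\<close> yields its sign
      directly; at a double root \<open>wr\<close> degenerates to 0 <= 0, and its first order term
      nearby decides.\<close>
    define B where "B = b0 - b1 * \<alpha> + b2 * \<alpha>\<^sup>2"
    have "0 \<le> B"
    proof (cases "\<alpha> = \<beta>")
      case False
      have "0 \<le> B * (a1 - 2 * a2 * \<alpha>)"
        using wr[of "- \<alpha>"] unfolding B_def a0_eq a1_eq
        by (simp add: power2_eq_square algebra_simps)
      also have "a1 - 2 * a2 * \<alpha> = a2 * (\<beta> - \<alpha>)" unfolding a1_eq by (simp add: algebra_simps)
      finally have "0 \<le> B * (a2 * (\<beta> - \<alpha>))" .
      moreover have "0 < a2 * (\<beta> - \<alpha>)" using False le a2 by simp
      ultimately show ?thesis by (simp only: zero_le_mult_iff) linarith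
    next
      case True
      define e where "e = b1 - 2 * b2 * \<alpha>"
      have *: "0 \<le> 2 * B * h + e * h\<^sup>2" for h
      proof -
        have "0 \<le> (b0 + b1 * (h - \<alpha>) + b2 * (h - \<alpha>)\<^sup>2) * (a1 + 2 * a2 * (h - \<alpha>))
          - (b1 + 2 * b2 * (h - \<alpha>)) * (a0 + a1 * (h - \<alpha>) + a2 * (h - \<alpha>)\<^sup>2)"
          using wr[of "h - \<alpha>"] by simp
        also have "\<dots> = a2 * (2 * B * h + e * h\<^sup>2)"
          unfolding a0_eq a1_eq True[symmetric] B_def e_def
          by (simp add: power2_eq_square algebra_simps)
        finally show ?thesis using a2 by (simp add: zero_le_mult_iff)
      qed
      show ?thesis
      proof (rule ccontr)
        assume "\<not> 0 \<le> B"
        then have n: "B < 0" by simp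
        define h where "h = - B / (\<bar>e\<bar> + 1)"
        have h: "0 < h" using n by (simp add: h_def divide_neg_pos)
        have "e * h \<le> \<bar>e\<bar> * h" using h by (intro mult_right_mono) auto
        also have "\<bar>e\<bar> * h \<le> - B" using n by (simp add: h_def field_simps)
        finally have "(2 * B + e * h) * h < 0" using n h by (intro mult_neg_pos) auto
        then show False using *[of h] by (simp add: power2_eq_square algebra_simps)
      qed
    qed
    \<comment> \<open>This is \<open>Q\<close> with \<alpha> in place of \<open>D\<close>. The
      coefficient of \<open>D\<close> in \<open>Q\<close> is nonpositive, so going from \<alpha> to
      the smaller \<open>D\<close> can only increase the value.\<close>
    then have "0 \<le> a2\<^sup>2 * \<beta>\<^sup>2 * B" by simp
    also have "\<dots> = a0 * (b2 * a0 - b0 * a2) - a1 * (b1 * a0 - b0 * a1) + \<alpha> * a2 * (b1 * a0 - b0 * a1)"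
      unfolding B_def a0_eq a1_eq by (simp add: power2_eq_square algebra_simps)
    also have "\<dots> \<le> Q"
    proof -
      have "\<alpha> * (a2 * (b1 * a0 - b0 * a1)) \<le> D * (a2 * (b1 * a0 - b0 * a1))"
        using \<open>D < \<alpha>\<close> a2 m10 by (intro mult_right_mono_neg) (auto simp: mult_le_0_iff)
      then show ?thesis by (simp add: Q_def algebra_simps)
    qed
    finally show ?thesis .
  qed
  define E where "E = a0 - a1 * D + a2 * D\<^sup>2"
  define N where "N = b0 - b1 * D + b2 * D\<^sup>2"
  define m where "m = b0 * a1 - b1 * a0"
  have E: "0 < E" using aD by (simp add: E_def)
  have "N / E - (b0 / a0 + D * m / a0\<^sup>2) = (N * a0\<^sup>2 - b0 * a0 * E - D * m * E) / (E * a0\<^sup>2)"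
    using a0 E by (simp add: field_simps power2_eq_square)
  also have "N * a0\<^sup>2 - b0 * a0 * E - D * m * E = D\<^sup>2 * Q"
    unfolding N_def E_def m_def Q_def by (simp add: power2_eq_square algebra_simps)
  also have "D\<^sup>2 * Q / (E * a0\<^sup>2) \<ge> 0" using Q E by simp
  finally show ?thesis by (simp add: N_def E_def m_def)
qed

text \<open>The average of the translations by \<open>-2\<close> in the two variables.\<close>

definition mix :: "'i \<Rightarrow> 'i \<Rightarrow> ('i set \<Rightarrow> real) \<Rightarrow> 'i set \<Rightarrow> real" where
  "mix z w c S = c S - dcoeff z c S - dcoeff w c S"

lemma maff_mix: "maff I (mix z w c) y = maff I c y - maff I (dcoeff z c) y - maff I (dcoeff w c) y"
  using maff_linear[of I 1 "\<lambda>S. 1 * c S + (-1) * dcoeff z c S" "-1" "dcoeff w c" y]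
    maff_linear[of I 1 c "-1" "dcoeff z c" y] by (simp add: mix_def[abs_def])

lemma dcoeff_mix: "dcoeff j (mix z w c) = mix z w (dcoeff j c)"
  by (auto simp: dcoeff_def mix_def fun_eq_iff insert_commute)

lemma hstable_mix_op: "finite I \<Longrightarrow> hstable I c \<Longrightarrow> z \<in> I \<Longrightarrow> w \<in> I \<Longrightarrow> hstable I (mix z w c)"
  using hstable_mix[of I c z w 1 1] by (simp add: mix_def[abs_def])

lemma maff_diag:
  fixes y :: "'i \<Rightarrow> real"
  assumes "finite I" "z \<in> I" "w \<in> I" "z \<noteq> w"
  shows "maff I c (y(z := y z + x, w := y w + x)) =
    maff I c y + (maff I (dcoeff z c) y + maff I (dcoeff w c) y) * x + maff I (dcoeff z (dcoeff w c)) y * x\<^sup>2"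
proof -
  have "maff I c (y(z := y z + x, w := y w + x)) =
      maff I c (y(z := y z + x)) + x * maff I (dcoeff w c) (y(z := y z + x))"
    using maff_upd[OF assms(1,3), of c "y(z := y z + x)" x] assms(4) by simp
  then show ?thesis
    unfolding maff_upd[OF assms(1,2)] by (simp add: power2_eq_square algebra_simps)
qed

text \<open>To the upper right of \<open>y\<close> the two barriers keep adding up to at most
  \<kappa> < 1, which gives positivity. For the second claim: \<open>mix\<close> raises the barrier
  of \<open>j\<close> by at most \<delta> times its downward slope along the diagonal of
  \<open>z\<close> and \<open>w\<close>. By convexity along this diagonal, the move from
  \<open>y\<close> to \<open>y'\<close> has already lowered the barrier by at least that
  much.\<close>

lemma above_mix:
  fixes \<kappa> :: real
  assumes fin: "finite I" and st: "hstable I c" and ab: "above I c y"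
    and z: "z \<in> I" and w: "w \<in> I" and zw: "z \<noteq> w"
    and \<kappa>: "barrier I c z y + barrier I c w y \<le> \<kappa>" "\<kappa> < 1"
    and \<delta>: "\<delta> = 1 / (1 - \<kappa>)"
  defines "y' \<equiv> y(z := y z + \<delta>, w := y w + \<delta>)"
  shows "above I (mix z w c) y'"
    and "j \<in> I \<Longrightarrow> barrier I (mix z w c) j y' \<le> barrier I c j y"
proof -
  have \<delta>0: "0 < \<delta>" using \<kappa> \<delta> by simp
  have yy: "y k \<le> y' k" for k using \<delta>0 by (auto simp: y'_def)
  have low: "maff I (dcoeff z c) s + maff I (dcoeff w c) s \<le> \<kappa> * maff I c s" if s: "\<And>k. k \<in> I \<Longrightarrow> y k \<le> s k" for s
  proof -
    have "0 < maff I c s" using ab s by (auto simp: above_def)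
    moreover have "barrier I c z s + barrier I c w s \<le> \<kappa>"
      using barrier_antimono[OF fin st ab z, of s] barrier_antimono[OF fin st ab w, of s] s \<kappa>(1) by simp
    ultimately show ?thesis unfolding barrier_def by (simp add: field_simps)
  qed
  show "above I (mix z w c) y'"
    unfolding above_def maff_mix
  proof (intro allI impI)
    fix s :: "'a \<Rightarrow> real" assume s: "\<forall>i\<in>I. y' i \<le> s i"
    then have ys: "\<And>k. k \<in> I \<Longrightarrow> y k \<le> s k" using yy order_trans by blast
    then have p: "0 < maff I c s" using ab by (auto simp: above_def)
    have "\<kappa> * maff I c s < 1 * maff I c s" using p \<kappa> by (intro mult_strict_right_mono) auto
    with low[OF ys] show "0 < maff I c s - maff I (dcoeff z c) s - maff I (dcoeff w c) s" by simp
  qed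
  assume j: "j \<in> I"
  define a0 where "a0 = maff I c y'"
  define a1 where "a1 = maff I (dcoeff z c) y' + maff I (dcoeff w c) y'"
  define a2 where "a2 = maff I (dcoeff z (dcoeff w c)) y'"
  define b0 where "b0 = maff I (dcoeff j c) y'"
  define b1 where "b1 = maff I (dcoeff z (dcoeff j c)) y' + maff I (dcoeff w (dcoeff j c)) y'"
  define b2 where "b2 = maff I (dcoeff z (dcoeff w (dcoeff j c))) y'"
  define Y where "Y x = y'(z := y' z + x, w := y' w + x)" for x
  have A: "maff I c (Y x) = a0 + a1 * x + a2 * x\<^sup>2" for x
    unfolding Y_def maff_diag[OF fin z w zw] a0_def a1_def a2_def ..
  have B: "maff I (dcoeff j c) (Y x) = b0 + b1 * x + b2 * x\<^sup>2" for x
    unfolding Y_def maff_diag[OF fin z w zw] b0_def b1_def b2_def ..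
  have A': "maff I (dcoeff z c) (Y x) + maff I (dcoeff w c) (Y x) = a1 + 2 * a2 * x" for x
    unfolding Y_def maff_diag[OF fin z w zw] a1_def a2_def
    by (simp add: dcoeff_dcoeff_same dcoeff_commute[of w] algebra_simps)
  have B': "maff I (dcoeff z (dcoeff j c)) (Y x) + maff I (dcoeff w (dcoeff j c)) (Y x) = b1 + 2 * b2 * x" for x
    unfolding Y_def maff_diag[OF fin z w zw] b1_def b2_def
    by (simp add: dcoeff_dcoeff_same dcoeff_commute[of w] algebra_simps)
  have Ym: "Y (- \<delta>) = y" using zw by (auto simp: Y_def y'_def fun_eq_iff)
  have pos: "0 < a0 + a1 * x + a2 * x\<^sup>2" if "- \<delta> \<le> x" for x
    using ab that zw unfolding A[symmetric] above_def Y_def y'_def by auto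
  \<comment> \<open>The quadratic on the diagonal has real roots: Rayleigh for \<open>z\<close> and
    \<open>w\<close>, then the inequality of arithmetic and geometric means.\<close>
  have disc: "4 * a0 * a2 \<le> a1\<^sup>2"
  proof -
    have "a0 * a2 \<le> maff I (dcoeff z c) y' * maff I (dcoeff w c) y'"
      unfolding a0_def a2_def by (rule rayleigh[OF fin st z w])
    also have "4 * \<dots> \<le> a1\<^sup>2"
      using sum_squares_bound[of "maff I (dcoeff z c) y'" "maff I (dcoeff w c) y'"]
      unfolding a1_def power2_sum by (simp add: mult_ac)
    finally show ?thesis by simp
  qed
  \<comment> \<open>The Rayleigh inequalities for the pairs \<open>z\<close>, \<open>j\<close> and
    \<open>w\<close>, \<open>j\<close> add up to the sign condition on the Wronskian of numerator
    and denominator.\<close>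
  have wr: "(b1 + 2 * b2 * x) * (a0 + a1 * x + a2 * x\<^sup>2) \<le> (b0 + b1 * x + b2 * x\<^sup>2) * (a1 + 2 * a2 * x)" for x
    unfolding A[symmetric] B[symmetric] A'[symmetric] B'[symmetric]
    using rayleigh[OF fin st z j, of "Y x"] rayleigh[OF fin st w j, of "Y x"]
    by (simp add: algebra_simps)
  have conv: "b0 / a0 + \<delta> * (b0 * a1 - b1 * a0) / a0\<^sup>2 \<le> barrier I c j y"
    using quadratic_ratio_convex[of \<delta> a0 a1 a2 b1 b2 b0, OF _ pos disc wr] \<delta>0
    unfolding barrier_def using A[of "-\<delta>"] B[of "-\<delta>"] by (simp add: Ym)
  have a0: "0 < a0" using pos[of 0] \<delta>0 by simp
  have N: "0 \<le> b0 * a1 - b1 * a0" using wr[of 0] by simp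
  have "a1 \<le> \<kappa> * a0" unfolding a0_def a1_def by (rule low) (rule yy)
  then have le: "a0 * (1 - \<kappa>) \<le> a0 - a1" by (simp add: algebra_simps)
  have pa: "0 < a0 * (1 - \<kappa>)" using a0 \<kappa> by simp
  have "barrier I (mix z w c) j y' = (b0 - b1) / (a0 - a1)"
    unfolding barrier_def dcoeff_mix maff_mix a0_def a1_def b0_def b1_def by (simp add: algebra_simps)
  also have "\<dots> = b0 / a0 + (b0 * a1 - b1 * a0) / a0 / (a0 - a1)"
  proof -
    define d where "d = a0 - a1"
    have "0 < d" "a1 = a0 - d" using le pa by (auto simp: d_def)
    then show ?thesis using a0 by (simp add: field_simps)
  qed
  also have "\<dots> \<le> b0 / a0 + (b0 * a1 - b1 * a0) / a0 / (a0 * (1 - \<kappa>))"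
    using le pa N a0 by (intro add_left_mono divide_left_mono) auto
  also have "\<dots> = b0 / a0 + \<delta> * (b0 * a1 - b1 * a0) / a0\<^sup>2"
    unfolding \<delta> by (simp add: power2_eq_square)
  also note conv
  finally show "barrier I (mix z w c) j y' \<le> barrier I c j y" .
qed

section \<open>The barrier step iterated over all indices\<close>

definition mixes :: "'j list \<Rightarrow> (('j \<times> bool) set \<Rightarrow> real) \<Rightarrow> ('j \<times> bool) set \<Rightarrow> real" where
  "mixes js = fold (\<lambda>j. mix (j, False) (j, True)) js"

text \<open>The Boolean in a variable tells to which of the two determinants it belongs.
  \<open>h j\<close> selects the one in which index \<open>j\<close> is translated, so
  \<open>h\<close> encodes a partition into two halves.\<close>

definition translates :: "('j \<Rightarrow> bool) \<Rightarrow> 'j list \<Rightarrow> (('j \<times> bool) set \<Rightarrow> real) \<Rightarrow> ('j \<times> bool) set \<Rightarrow> real" where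
  "translates h js = fold (\<lambda>j. translate (j, h j) (-2)) js"

lemma mixes_simps [simp]:
  "mixes [] c = c" "mixes (j # js) c = mixes js (mix (j, False) (j, True) c)"
  by (simp_all add: mixes_def)

lemma translates_simps [simp]:
  "translates h [] c = c" "translates h (j # js) c = translates h js (translate (j, h j) (-2) c)"
  by (simp_all add: translates_def)

lemma hstable_mixes:
  "finite J \<Longrightarrow> hstable (J \<times> UNIV) c \<Longrightarrow> set js \<subseteq> J \<Longrightarrow> hstable (J \<times> UNIV) (mixes js c)"
proof (induction js arbitrary: c)
  case (Cons j js)
  then show ?case using Cons.IH[of "mix (j, False) (j, True) c"] by (simp add: hstable_mix_op)
qed simp

text \<open>Each step moves only the pair of variables of its own index, by \<delta>, and increases
  no barrier. So the bound \<kappa> persists for the indices still to come, and distinctness makes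
  each listed pair move exactly once.\<close>

lemma above_mixes:
  fixes \<kappa> :: real
  assumes fin: "finite J" and \<kappa>: "\<kappa> < 1" and \<delta>: "\<delta> = 1 / (1 - \<kappa>)"
  shows "hstable (J \<times> UNIV) c \<Longrightarrow> above (J \<times> UNIV) c y \<Longrightarrow> set js \<subseteq> J \<Longrightarrow> distinct js \<Longrightarrow>
    (\<And>j. j \<in> set js \<Longrightarrow> barrier (J \<times> UNIV) c (j, False) y + barrier (J \<times> UNIV) c (j, True) y \<le> \<kappa>) \<Longrightarrow>
    above (J \<times> UNIV) (mixes js c) (\<lambda>(j, b). y (j, b) + (if j \<in> set js then \<delta> else 0))"
proof (induction js arbitrary: c y)
  case Nil
  then show ?case by simp
next
  case (Cons j js)
  let ?I = "J \<times> (UNIV :: bool set)"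
  let ?c = "mix (j, False) (j, True) c"
  let ?y = "y((j, False) := y (j, False) + \<delta>, (j, True) := y (j, True) + \<delta>)"
  have fI: "finite ?I" using fin by simp
  have m: "(j, False) \<in> ?I" "(j, True) \<in> ?I" "(j, False) \<noteq> (j, True)" using Cons.prems by auto
  have k: "barrier ?I c (j, False) y + barrier ?I c (j, True) y \<le> \<kappa>" using Cons.prems by simp
  note step = above_mix[OF fI Cons.prems(1,2) m k \<kappa> \<delta>]
  have "above ?I (mixes js ?c) (\<lambda>(k, b). ?y (k, b) + (if k \<in> set js then \<delta> else 0))"
  proof (rule Cons.IH)
    show "hstable ?I ?c" by (intro hstable_mix_op fI Cons.prems m)
    show "above ?I ?c ?y" by (rule step(1))
    fix i assume i: "i \<in> set js"
    then have "(i, False) \<in> ?I" "(i, True) \<in> ?I" using Cons.prems by auto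
    then have "barrier ?I ?c (i, False) ?y + barrier ?I ?c (i, True) ?y
        \<le> barrier ?I c (i, False) y + barrier ?I c (i, True) y"
      by (intro add_mono step(2))
    also have "\<dots> \<le> \<kappa>" using Cons.prems i by simp
    finally show "barrier ?I ?c (i, False) ?y + barrier ?I ?c (i, True) ?y \<le> \<kappa>" .
  qed (use Cons.prems in auto)
  moreover have "(\<lambda>(k, b). ?y (k, b) + (if k \<in> set js then \<delta> else 0))
      = (\<lambda>(k, b). y (k, b) + (if k \<in> set (j # js) then \<delta> else 0))"
    using Cons.prems(4) by (auto simp: fun_eq_iff)
  ultimately show ?case by simp
qed

subsection \<open>Choosing a summand of an average\<close>

text \<open>To the right of its largest root, the modulus of a real-rooted polynomial increases.\<close>

lemma hstable_diag_mono:
  fixes \<rho> :: real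
  assumes "finite I" "hstable I c" and pos: "\<And>x. \<rho> \<le> x \<Longrightarrow> 0 < maff I c (\<lambda>_. x)" and x: "\<rho> \<le> x"
  shows "maff I c (\<lambda>_. \<rho>) \<le> maff I c (\<lambda>_. x)"
proof -
  define P :: "complex poly" where "P = (\<Sum>S\<in>Pow I. monom (of_real (c S)) (card S))"
  have P: "poly P z = maff I c (\<lambda>_. z)" for z
    by (simp add: P_def maff_def poly_sum poly_monom)
  have Pr: "poly P (of_real r) = of_real (maff I c (\<lambda>_. r))" for r
    unfolding P of_real_maff ..
  have "P \<noteq> 0" using Pr[of \<rho>] pos[of \<rho>] by force
  from alg_closed_imp_factorization[OF this]
  obtain A where A: "size A = degree P \<and> P = Polynomial.smult (lead_coeff P) (\<Prod>a\<in>#A. [:- a, 1:])" ..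
  define l where "l = lead_coeff P"
  have A: "P = Polynomial.smult l (\<Prod>a\<in>#A. [:- a, 1:])"
    unfolding l_def by (rule conjunct2[OF A])
  \<comment> \<open>A nonreal root or its conjugate would lie in the upper half plane, against
    stability; a real root lies left of \<rho> by positivity.\<close>
  have root: "Im a = 0 \<and> Re a < \<rho>" if "a \<in># A" for a
  proof -
    have "poly (\<Prod>a\<in>#A. [:- a, 1:]) a = 0"
      using that by (auto simp: poly_prod_mset prod_mset_zero_iff)
    then have "poly P a = 0" unfolding A by simp
    then have 0: "maff I c (\<lambda>_. a) = 0" unfolding P .
    then have r1: "maff I c (\<lambda>_. cnj a) = 0" using cnj_maff[of I c "\<lambda>_. a"] by simp
    have "\<not> 0 < Im a"
      using assms(2) 0 unfolding hstable_def by (auto dest: spec[of _ "\<lambda>_. a"])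
    moreover have "\<not> 0 < Im (cnj a)"
      using assms(2) r1 unfolding hstable_def by (auto dest: spec[of _ "\<lambda>_. cnj a"])
    ultimately have im: "Im a = 0" by simp
    then have "of_real (Re a) = a" by (simp add: complex_eq_iff)
    then have "of_real (maff I c (\<lambda>_. Re a)) = (0::complex)" using 0 unfolding of_real_maff by simp
    then show ?thesis using im pos[of "Re a"] by force
  qed
  have "\<forall>a\<in>#A. Im a = 0 \<and> Re a < \<rho>" using root by blast
  then have "cmod (poly (\<Prod>a\<in>#A. [:- a, 1:]) (of_real \<rho>)) \<le> cmod (poly (\<Prod>a\<in>#A. [:- a, 1:]) (of_real x))"
  proof (induction A)
    case (add a A)
    have "cmod (of_real \<rho> - a) \<le> cmod (of_real x - a)"
      using add.prems x by (simp add: cmod_def)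
    moreover have "poly (\<Prod>b\<in>#add_mset a A. [:- b, 1:]) z = (z - a) * poly (\<Prod>b\<in>#A. [:- b, 1:]) z" for z
      by (simp add: algebra_simps)
    moreover have "cmod (poly (\<Prod>a\<in>#A. [:- a, 1:]) (of_real \<rho>)) \<le> cmod (poly (\<Prod>a\<in>#A. [:- a, 1:]) (of_real x))"
      using add by simp
    ultimately show ?case
      by (simp only: norm_mult mult_mono norm_ge_zero)
  qed simp
  then have "cmod (poly P (of_real \<rho>)) \<le> cmod (poly P (of_real x))"
    unfolding A by (simp add: norm_mult mult_left_mono)
  then show ?thesis using pos[of \<rho>] pos[OF x] unfolding Pr by simp
qed

text \<open>Move from \<open>c1\<close> towards \<open>c0\<close>. At the last parameter with a root beyond \<open>\<rho>\<close>, the value at that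
  root is a limit of values that are at least those at \<open>\<rho>\<close>, which stay away from zero.\<close>

lemma hstable_segment_positive:
  fixes \<rho> R :: real
  assumes fin: "finite I"
    and st: "\<And>\<tau>. 0 \<le> \<tau> \<Longrightarrow> \<tau> \<le> 1 \<Longrightarrow> hstable I (\<lambda>S. (1 - \<tau>) * c0 S + \<tau> * c1 S)"
    and c1: "\<And>x. \<rho> \<le> x \<Longrightarrow> 0 < maff I c1 (\<lambda>_. x)"
    and c0: "0 < maff I c0 (\<lambda>_. \<rho>)"
    and R: "\<And>x. R \<le> x \<Longrightarrow> 0 < maff I c0 (\<lambda>_. x)"
    and x: "\<rho> \<le> x"
  shows "0 < maff I c0 (\<lambda>_. x)"
proof (rule ccontr)
  assume neg: "\<not> 0 < maff I c0 (\<lambda>_. x)"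
  define f where "f \<tau> x = maff I (\<lambda>S. (1 - \<tau>) * c0 S + \<tau> * c1 S) (\<lambda>_. x)" for \<tau> x :: real
  have f: "f \<tau> x = (1 - \<tau>) * maff I c0 (\<lambda>_. x) + \<tau> * maff I c1 (\<lambda>_. x)" for \<tau> x
    unfolding f_def using maff_linear[of I "1 - \<tau>" c0 \<tau> c1 "\<lambda>_. x"] by simp
  have comb: "0 < (1 - \<tau>) * a + \<tau> * b" if "0 < a" "0 < b" "0 \<le> \<tau>" "\<tau> \<le> 1" for a b \<tau> :: real
    using that by (cases "\<tau> = 0") (auto intro: add_nonneg_pos)
  have cont: "continuous_on X (\<lambda>p. f (fst p) (snd p))" for X
    unfolding f by (intro continuous_intros)
  have contx: "continuous_on X (f \<tau>)" for X \<tau>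
    unfolding f by (intro continuous_intros)
  have ivt: "\<exists>z. \<rho> \<le> z \<and> z \<le> x \<and> f \<tau> z = 0" if "0 < f \<tau> \<rho>" "f \<tau> x \<le> 0" "\<rho> \<le> x" for \<tau> x
    using IVT2'[of "f \<tau>" x 0 \<rho>] that contx by (auto simp: less_imp_le)
  have f\<rho>: "0 < f \<tau> \<rho>" if "0 \<le> \<tau>" "\<tau> \<le> 1" for \<tau>
    unfolding f using comb c0 c1[of \<rho>] that by auto
  \<comment> \<open>Beyond the maximum of \<rho> and \<open>R\<close> both ends of the segment are
    positive, so no zero escapes to infinity. Compactness then provides the last parameter with a
    zero.\<close>
  define Z where "Z = {p \<in> {0..1} \<times> {\<rho>..max \<rho> R}. f (fst p) (snd p) = 0}"
  have "compact Z"
  proof -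
    have "closed (({0..1} \<times> {\<rho>..max \<rho> R}) \<inter> (\<lambda>p. f (fst p) (snd p)) -` {0})"
      by (rule continuous_closed_preimage) (auto intro: cont closed_Times)
    then have "compact (({0..1} \<times> {\<rho>..max \<rho> R}) \<inter> (({0..1} \<times> {\<rho>..max \<rho> R}) \<inter> (\<lambda>p. f (fst p) (snd p)) -` {0}))"
      by (intro compact_Int_closed compact_Times compact_Icc)
    then show ?thesis unfolding Z_def by (rule back_subst[of compact]) auto
  qed
  moreover have "Z \<noteq> {}"
  proof -
    have "x < R" using neg R[of x] by force
    obtain z where "\<rho> \<le> z" "z \<le> x" "f 0 z = 0"
      using ivt[of 0 x] c0 neg x by (auto simp: f)
    then have "(0, z) \<in> Z" using \<open>x < R\<close> by (auto simp: Z_def)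
    then show ?thesis by blast
  qed
  ultimately obtain p where p: "p \<in> Z" "\<And>q. q \<in> Z \<Longrightarrow> fst q \<le> fst p"
    using continuous_attains_sup[OF _ _ continuous_on_fst[OF continuous_on_id], of Z] by blast
  define t where "t = fst p"
  define z where "z = snd p"
  have t: "0 \<le> t" "t \<le> 1" "\<rho> \<le> z" "f t z = 0" using p(1) by (auto simp: Z_def t_def z_def)
  have "t \<noteq> 1" using t c1[of z] by (auto simp: f)
  have pos: "0 < f \<tau> x" if "t < \<tau>" "\<tau> \<le> 1" "\<rho> \<le> x" for \<tau> x
  proof (rule ccontr)
    assume "\<not> 0 < f \<tau> x"
    then have "f \<tau> x \<le> 0" by simp
    moreover have "0 < f \<tau> \<rho>" using that t(1) by (intro f\<rho>) auto
    ultimately obtain w where w: "\<rho> \<le> w" "w \<le> x" "f \<tau> w = 0"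
      using ivt \<open>\<rho> \<le> x\<close> by blast
    have "w \<le> max \<rho> R"
    proof (rule ccontr)
      assume "\<not> w \<le> max \<rho> R"
      then have "0 < f \<tau> w" unfolding f using that t w by (intro comb R c1) auto
      with w show False by simp
    qed
    then have "(\<tau>, w) \<in> Z" using w that t by (auto simp: Z_def)
    with p(2)[of "(\<tau>, w)"] that show False by (simp add: t_def)
  qed
  have le: "f \<tau> \<rho> \<le> f \<tau> z" if "t < \<tau>" "\<tau> \<le> 1" for \<tau>
    unfolding f_def by (rule hstable_diag_mono) (use fin st pos that t in \<open>auto simp: f_def\<close>)
  have "((\<lambda>\<tau>. f \<tau> z - f \<tau> \<rho>) \<longlongrightarrow> f t z - f t \<rho>) (at_right t)"
    unfolding f by (intro tendsto_intros)
  moreover have "eventually (\<lambda>\<tau>. 0 \<le> f \<tau> z - f \<tau> \<rho>) (at_right t)"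
    unfolding eventually_at_right_field using le t(2) \<open>t \<noteq> 1\<close>
    by (intro exI[of _ 1]) auto
  ultimately have "0 \<le> f t z - f t \<rho>" by (intro tendsto_lowerbound) auto
  with t f\<rho>[of t] show False by simp
qed

text \<open>One of the two is positive at \<rho> because their average is. The way from the average
  to that one is half of the given stable segment, so \<open>hstable_segment_positive\<close>
  applies; this takes the place of a common interlacing. \<open>R0\<close> and \<open>R1\<close> fix
  the signs at infinity.\<close>

lemma hstable_average_positive:
  fixes \<rho> R0 R1 :: real
  assumes fin: "finite I"
    and st: "\<And>\<tau>. 0 \<le> \<tau> \<Longrightarrow> \<tau> \<le> 1 \<Longrightarrow> hstable I (\<lambda>S. (1 - \<tau>) * c0 S + \<tau> * c1 S)"
    and av: "\<And>x. \<rho> \<le> x \<Longrightarrow> 0 < maff I (\<lambda>S. 1/2 * c0 S + 1/2 * c1 S) (\<lambda>_. x)"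
    and R0: "\<And>x. R0 \<le> x \<Longrightarrow> 0 < maff I c0 (\<lambda>_. x)"
    and R1: "\<And>x. R1 \<le> x \<Longrightarrow> 0 < maff I c1 (\<lambda>_. x)"
  shows "(\<forall>x\<ge>\<rho>. 0 < maff I c0 (\<lambda>_. x)) \<or> (\<forall>x\<ge>\<rho>. 0 < maff I c1 (\<lambda>_. x))"
proof -
  have "0 < maff I c0 (\<lambda>_. \<rho>) \<or> 0 < maff I c1 (\<lambda>_. \<rho>)"
    using av[of \<rho>] maff_linear[of I "1/2" c0 "1/2" c1 "\<lambda>_. \<rho>"] by auto
  then show ?thesis
  proof
    assume p: "0 < maff I c0 (\<lambda>_. \<rho>)"
    have "0 < maff I c0 (\<lambda>_. x)" if "\<rho> \<le> x" for x
    proof (rule hstable_segment_positive[OF fin _ av p R0 that])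
      fix \<tau> :: real assume "0 \<le> \<tau>" "\<tau> \<le> 1"
      then have "hstable I (\<lambda>S. (1 - \<tau> / 2) * c0 S + \<tau> / 2 * c1 S)" by (intro st) auto
      then show "hstable I (\<lambda>S. (1 - \<tau>) * c0 S + \<tau> * (1/2 * c0 S + 1/2 * c1 S))"
        by (rule back_subst[of "hstable I"]) (auto simp: fun_eq_iff field_simps)
    qed
    then show ?thesis by blast
  next
    assume p: "0 < maff I c1 (\<lambda>_. \<rho>)"
    have "0 < maff I c1 (\<lambda>_. x)" if "\<rho> \<le> x" for x
    proof (rule hstable_segment_positive[OF fin _ av p R1 that])
      fix \<tau> :: real assume "0 \<le> \<tau>" "\<tau> \<le> 1"
      then have "hstable I (\<lambda>S. (1 - (1 - \<tau> / 2)) * c0 S + (1 - \<tau> / 2) * c1 S)" by (intro st) auto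
      then show "hstable I (\<lambda>S. (1 - \<tau>) * c1 S + \<tau> * (1/2 * c0 S + 1/2 * c1 S))"
        by (rule back_subst[of "hstable I"]) (auto simp: fun_eq_iff field_simps)
    qed
    then show ?thesis by blast
  qed
qed

lemma mixes_linear:
  "mixes js (\<lambda>S. r * c S + s * c' S) = (\<lambda>S. r * mixes js c S + s * mixes js c' S)"
proof (induction js arbitrary: c c')
  case (Cons j js)
  have "mix (j, False) (j, True) (\<lambda>S. r * c S + s * c' S)
      = (\<lambda>S. r * mix (j, False) (j, True) c S + s * mix (j, False) (j, True) c' S)"
    by (auto simp: mix_def dcoeff_def fun_eq_iff algebra_simps)
  with Cons.IH show ?case by simp
qed simp

lemma dcoeff_translate: "dcoeff i (translate z r c) = translate z r (dcoeff i c)"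
  using dcoeff_linear[of i 1 c r "dcoeff z c"] by (simp add: translate_def[abs_def] dcoeff_commute[of i z])

lemma above_diag:
  assumes "finite I" "above I c y"
  obtains R :: real where "\<And>x. R \<le> x \<Longrightarrow> 0 < maff I c (\<lambda>_. x)"
proof
  fix x assume x: "(\<Sum>i\<in>I. \<bar>y i\<bar>) \<le> x"
  have "y i \<le> x" if "i \<in> I" for i
    using member_le_sum[of i I "\<lambda>i. \<bar>y i\<bar>"] that assms(1) x by force
  then show "0 < maff I c (\<lambda>_. x)" using assms(2) by (auto simp: above_def)
qed

text \<open>The method of interlacing polynomials: \<open>h\<close> is decided index by index, and
  \<rho> stays the same throughout because some choice is at least as good as the average. The
  barrier hypotheses are carried along to ensure, via \<open>above_mixes\<close>, that both
  candidates are positive far out on the diagonal.\<close>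

lemma exists_translates:
  fixes \<kappa> \<rho> :: real
  assumes fin: "finite J" and \<kappa>: "\<kappa> < 1"
  shows "hstable (J \<times> UNIV) c \<Longrightarrow> above (J \<times> UNIV) c y \<Longrightarrow> set js \<subseteq> J \<Longrightarrow> distinct js \<Longrightarrow>
    (\<And>j. j \<in> set js \<Longrightarrow> barrier (J \<times> UNIV) c (j, False) y + barrier (J \<times> UNIV) c (j, True) y \<le> \<kappa>) \<Longrightarrow>
    (\<And>x. \<rho> \<le> x \<Longrightarrow> 0 < maff (J \<times> UNIV) (mixes js c) (\<lambda>_. x)) \<Longrightarrow>
    \<exists>h. \<forall>x\<ge>\<rho>. 0 < maff (J \<times> UNIV) (translates h js c) (\<lambda>_. x)"
proof (induction js arbitrary: c y)
  case (Cons j js)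
  let ?I = "J \<times> (UNIV :: bool set)"
  define C where "C b = translate (j, b) (-2) c" for b
  \<comment> \<open>Raising this coordinate by 2 undoes the translation, so all barriers of
    \<open>C b\<close> at \<open>Y b\<close> are those of \<open>c\<close> at
    \<open>y\<close>.\<close>
  define Y where "Y b = y((j, b) := y (j, b) + 2)" for b
  have fI: "finite ?I" using fin by simp
  have m: "(j, b) \<in> ?I" for b using Cons.prems by auto
  have stC: "hstable ?I (C b)" for b
    unfolding C_def by (intro hstable_translate fI m Cons.prems)
  have abC: "above ?I (C b) (Y b)" for b
    unfolding above_def C_def maff_translate[OF fI m]
  proof (intro allI impI)
    fix s assume s: "\<forall>i\<in>?I. Y b i \<le> s i"
    have "y i \<le> (s((j, b) := s (j, b) + of_real (-2))) i" if "i \<in> ?I" for i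
      using s[rule_format, OF that] by (auto simp: Y_def)
    then have "\<forall>i\<in>?I. y i \<le> (s((j, b) := s (j, b) + of_real (-2))) i" by blast
    then show "0 < maff ?I c (s((j, b) := s (j, b) + of_real (-2)))"
      using Cons.prems(2) unfolding above_def by blast
  qed
  have "(Y b)((j, b) := Y b (j, b) + of_real (-2)) = y" for b by (simp add: Y_def)
  then have barC: "barrier ?I (C b) i (Y b) = barrier ?I c i y" for b i
    unfolding barrier_def C_def dcoeff_translate maff_translate[OF fI m] by (simp only:)
  have sub: "set js \<subseteq> J" "distinct js" "j \<notin> set js" using Cons.prems by auto
  have k: "barrier ?I (C b) (i, False) (Y b) + barrier ?I (C b) (i, True) (Y b) \<le> \<kappa>"
    if "i \<in> set js" for b i
    unfolding barC using Cons.prems that by simp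
  have pos: "\<exists>R::real. \<forall>x\<ge>R. 0 < maff ?I (mixes js (C b)) (\<lambda>_. x)" for b
  proof -
    obtain R :: real where "\<And>x. R \<le> x \<Longrightarrow> 0 < maff ?I (mixes js (C b)) (\<lambda>_. x)"
      using above_diag[OF fI above_mixes[OF fin \<kappa> refl stC abC sub(1,2) k]] by blast
    then show ?thesis by blast
  qed
  have "\<exists>b. \<forall>x\<ge>\<rho>. 0 < maff ?I (mixes js (C b)) (\<lambda>_. x)"
  proof -
    obtain R0 R1 :: real where R: "\<And>x. R0 \<le> x \<Longrightarrow> 0 < maff ?I (mixes js (C False)) (\<lambda>_. x)"
      "\<And>x. R1 \<le> x \<Longrightarrow> 0 < maff ?I (mixes js (C True)) (\<lambda>_. x)" using pos[of False] pos[of True] by blast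
    have st: "hstable ?I (\<lambda>S. (1 - \<tau>) * mixes js (C False) S + \<tau> * mixes js (C True) S)"
      if "0 \<le> \<tau>" "\<tau> \<le> 1" for \<tau>
    proof -
      \<comment> \<open>A convex combination of the two translations just splits the total shift 2
        between the two derivatives, which \<open>hstable_mix\<close> allows for any nonnegative
        weights.\<close>
      have "hstable ?I (\<lambda>S. c S - 2 * (1 - \<tau>) * dcoeff (j, False) c S - 2 * \<tau> * dcoeff (j, True) c S)"
        using that by (intro hstable_mix fI m Cons.prems) auto
      also have "(\<lambda>S. c S - 2 * (1 - \<tau>) * dcoeff (j, False) c S - 2 * \<tau> * dcoeff (j, True) c S)
          = (\<lambda>S. (1 - \<tau>) * C False S + \<tau> * C True S)"
        by (auto simp: C_def translate_def fun_eq_iff algebra_simps)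
      finally show ?thesis
        unfolding mixes_linear[symmetric] by (intro hstable_mixes fin sub)
    qed
    have eq: "mix (j, False) (j, True) c = (\<lambda>S. 1/2 * C False S + 1/2 * C True S)"
      by (auto simp: C_def translate_def mix_def fun_eq_iff algebra_simps)
    have "0 < maff ?I (\<lambda>S. 1/2 * mixes js (C False) S + 1/2 * mixes js (C True) S) (\<lambda>_. x)"
      if "\<rho> \<le> x" for x
      using Cons.prems(6)[OF that] unfolding mixes_linear[symmetric] mixes_simps eq .
    from hstable_average_positive[OF fI st this R] show ?thesis by blast
  qed
  then obtain b where b: "\<And>x. \<rho> \<le> x \<Longrightarrow> 0 < maff ?I (mixes js (C b)) (\<lambda>_. x)" by blast
  obtain h where h: "\<forall>x\<ge>\<rho>. 0 < maff ?I (translates h js (C b)) (\<lambda>_. x)"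
    using Cons.IH[OF stC abC sub(1,2) k b] by blast
  have "translates (h(j := b)) (j # js) c = translates h js (C b)"
    unfolding translates_def C_def using sub(3) by (auto intro!: fold_cong[THEN fun_cong])
  with h show ?case by metis
qed auto

lemma maff_translates:
  assumes "finite J"
  shows "set js \<subseteq> J \<Longrightarrow> distinct js \<Longrightarrow>
    maff (J \<times> UNIV) (translates h js c) y =
    maff (J \<times> UNIV) c (\<lambda>(j, b). y (j, b) - of_real (if j \<in> set js \<and> h j = b then 2 else 0))"
proof (induction js arbitrary: c)
  case (Cons j js)
  have "maff (J \<times> UNIV) (translates h (j # js) c) y = maff (J \<times> UNIV) (translate (j, h j) (-2) c)
      (\<lambda>(j, b). y (j, b) - of_real (if j \<in> set js \<and> h j = b then 2 else 0))"
    using Cons by simp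
  also have "\<dots> = maff (J \<times> UNIV) c
      (\<lambda>(k, b). y (k, b) - of_real (if k \<in> set (j # js) \<and> h k = b then 2 else 0))"
    using assms Cons.prems by (subst maff_translate) (auto intro!: maff_cong)
  finally show ?case .
qed (simp add: case_prod_unfold)

subsection \<open>Determinants of weighted Gram matrices\<close>

text \<open>Induction on the variables: coefficients of sets containing the new variable are
  differences between its values 1 and 0, so reality at the 0/1 points makes all coefficients real.
  This spares an explicit expansion of the determinant.\<close>

lemma maff_exists:
  fixes f :: "('i \<Rightarrow> complex) \<Rightarrow> complex"
  assumes "finite J"
    and "\<And>y i h. i \<in> J \<Longrightarrow> f (y(i := h)) = f (y(i := 0)) + h * (f (y(i := 1)) - f (y(i := 0)))"
    and "\<And>y y'. (\<And>i. i \<in> J \<Longrightarrow> y i = y' i) \<Longrightarrow> f y = f y'"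
    and "\<And>y. (\<And>i. y i = 0 \<or> y i = 1) \<Longrightarrow> f y \<in> \<real>"
  obtains c where "\<And>y. f y = maff J c y"
  using assms
proof (induction J arbitrary: f thesis)
  case empty
  have "f y = maff {} (\<lambda>_. Re (f (\<lambda>_. 0))) y" for y
    using empty(3)[of y "\<lambda>_. 0"] empty(4)[of "\<lambda>_. 0"] by (simp add: maff_def)
  then show ?case by (rule empty(1))
next
  case (insert i J)
  have sub: "\<exists>c. \<forall>y. f (y(i := r)) = maff J c y" if r: "r = 0 \<or> r = 1" for r
  proof (rule insert.IH[of "\<lambda>y. f (y(i := r))"])
    fix y :: "'i \<Rightarrow> complex" and k h assume "k \<in> J"
    then have "k \<in> insert i J" "k \<noteq> i" using insert.hyps by auto
    then show "f ((y(k := h))(i := r)) = f ((y(k := 0))(i := r)) + h * (f ((y(k := 1))(i := r)) - f ((y(k := 0))(i := r)))"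
      using insert.prems(2)[of k "y(i := r)" h] by (simp only: fun_upd_twist[OF \<open>k \<noteq> i\<close>])
  next
    fix y y' :: "'i \<Rightarrow> complex" assume "\<And>k. k \<in> J \<Longrightarrow> y k = y' k"
    then show "f (y(i := r)) = f (y'(i := r))" by (intro insert.prems(3)) auto
  next
    fix y :: "'i \<Rightarrow> complex" assume "\<And>k. y k = 0 \<or> y k = 1"
    then show "f (y(i := r)) \<in> \<real>" using r by (intro insert.prems(4)) auto
  next
    fix c assume "\<And>y. f (y(i := r)) = maff J c y"
    then show "\<exists>c. \<forall>y. f (y(i := r)) = maff J c y" by blast
  qed
  obtain c0 where c0: "\<And>y. f (y(i := 0)) = maff J c0 y" using sub[of 0] by auto
  obtain c1 where c1: "\<And>y. f (y(i := 1)) = maff J c1 y" using sub[of 1] by auto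
  define c where "c S = (if i \<in> S then c1 (S - {i}) - c0 (S - {i}) else c0 S)" for S
  have fin: "finite (insert i J)" "i \<in> insert i J" "insert i J - {i} = J" using insert.hyps by auto
  have "f y = maff (insert i J) c y" for y
  proof -
    have "f y = maff J c0 y + y i * (maff J c1 y - maff J c0 y)"
      using insert.prems(2)[OF fin(2), of y "y i"] unfolding c0 c1 fun_upd_triv .
    also have "\<dots> = (\<Sum>S\<in>Pow J. of_real (c0 S) * prod y S + of_real (c1 S - c0 S) * (y i * prod y S))"
      unfolding maff_def by (simp add: sum_distrib_left sum.distrib sum_subtractf algebra_simps)
    also have "\<dots> = maff (insert i J) c y"
      unfolding maff_def sum_Pow_split[OF fin(1,2)] fin(3)
    proof (rule sum.cong[OF refl])
      fix S assume "S \<in> Pow J"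
      then have "i \<notin> S" "finite S" using insert.hyps finite_subset by auto
      then show "of_real (c0 S) * prod y S + of_real (c1 S - c0 S) * (y i * prod y S)
        = of_real (c S) * prod y S + of_real (c (insert i S)) * prod y (insert i S)"
        by (simp add: c_def)
    qed
    finally show ?thesis .
  qed
  then show ?case by (rule insert.prems(1))
qed

text \<open>Bordering by one row and one column turns the rank one update into an update of row 0
  only, and Laplace expansion along that row is affine in \<open>h\<close>.\<close>

lemma det_rank_one_affine:
  fixes B :: "complex mat" and u w :: "nat \<Rightarrow> complex"
  assumes B: "B \<in> carrier_mat d d"
  defines "F h \<equiv> det (mat d d (\<lambda>(a, b). B $$ (a, b) + h * (u a * w b)))"
  shows "F h = F 0 + h * (F 1 - F 0)"
proof -
  define U where "U = mat d 1 (\<lambda>(a, _::nat). u a)"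
  define W where "W h = mat 1 d (\<lambda>(_::nat, b). h * w b)" for h
  define M where "M h = four_block_mat (1\<^sub>m 1) (W (- h)) U B" for h
  have car: "U \<in> carrier_mat d 1" "W h \<in> carrier_mat 1 d" for h by (auto simp: U_def W_def)
  have M: "M h \<in> carrier_mat (Suc d) (Suc d)" for h
    using four_block_carrier_mat[of "1\<^sub>m 1" 1 1 B d d] B unfolding M_def by auto
  have FM: "F h = det (M h)" for h
  proof -
    let ?T = "four_block_mat (1\<^sub>m 1) (W h) (0\<^sub>m d 1) (1\<^sub>m d)"
    let ?B = "mat d d (\<lambda>(a, b). B $$ (a, b) + h * (u a * w b))"
    have T: "?T \<in> carrier_mat (Suc d) (Suc d)"
      using four_block_carrier_mat[of "1\<^sub>m 1" 1 1 "1\<^sub>m d :: complex mat" d d] by auto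
    have "M h * ?T = four_block_mat (1\<^sub>m 1 * 1\<^sub>m 1 + W (- h) * 0\<^sub>m d 1) (1\<^sub>m 1 * W h + W (- h) * 1\<^sub>m d)
        (U * 1\<^sub>m 1 + B * 0\<^sub>m d 1) (U * W h + B * 1\<^sub>m d)"
      unfolding M_def by (rule mult_four_block_mat) (use car B in auto)
    also have "1\<^sub>m 1 * 1\<^sub>m 1 + W (- h) * 0\<^sub>m d 1 = 1\<^sub>m 1"
      using right_mult_zero_mat[OF car(2), of "- h" 1] by simp
    also have "1\<^sub>m 1 * W h + W (- h) * 1\<^sub>m d = 0\<^sub>m 1 d"
      using car by (intro eq_matI) (auto simp: W_def)
    also have "U * 1\<^sub>m 1 + B * 0\<^sub>m d 1 = U"
      using right_mult_zero_mat[OF B, of 1] car(1) by simp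
    also have "U * W h + B * 1\<^sub>m d = ?B"
      using car B by (intro eq_matI) (auto simp: W_def U_def scalar_prod_def mult_ac add.commute)
    finally have "det (M h) * det ?T = det (four_block_mat (1\<^sub>m 1) (0\<^sub>m 1 d) U ?B)"
      by (simp only: det_mult[OF M T, symmetric])
    also have "\<dots> = F h"
      unfolding F_def by (subst det_four_block_mat_upper_right_zero[of _ 1 _ d]) (use car in auto)
    also have "det ?T = 1"
      by (subst det_four_block_mat_lower_left_zero[of _ 1 _ d]) (use car in auto)
    finally show ?thesis by simp
  qed
  have del: "mat_delete (M h) 0 j = mat_delete (M 0) 0 j" for h j
    using B car by (intro eq_matI) (auto simp: mat_delete_def M_def four_block_mat_def Let_def)
  have "det (M h) = (\<Sum>j<Suc d. M h $$ (0, j) * cofactor (M 0) 0 j)" for h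
    by (subst laplace_expansion_row[OF M, of 0]) (auto simp: cofactor_def del[of h])
  also have "(\<Sum>j<Suc d. M h $$ (0, j) * cofactor (M 0) 0 j)
      = cofactor (M 0) 0 0 - h * (\<Sum>j<d. w j * cofactor (M 0) 0 (Suc j))" for h
    unfolding sum.lessThan_Suc_shift
    using B car by (simp add: M_def four_block_mat_def Let_def W_def sum_distrib_left sum_negf mult_ac)
  finally have "F h = cofactor (M 0) 0 0 - h * (\<Sum>j<d. w j * cofactor (M 0) 0 (Suc j))" for h
    unfolding FM .
  then show ?thesis by simp
qed

text \<open>Bilinear, without conjugation, so that the value of a linear combination at a point is a
  pairing with its coefficients. The conjugate sits in \<open>gram\<close>, whose form at
  \<open>x\<close> is the sum of \<open>y i\<close> times the squared modulus of
  \<open>pairing d (v i) x\<close>.\<close>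

definition pairing :: "nat \<Rightarrow> (nat \<Rightarrow> complex) \<Rightarrow> (nat \<Rightarrow> complex) \<Rightarrow> complex" where
  "pairing d v x = (\<Sum>a<d. v a * x a)"

definition gram :: "nat \<Rightarrow> 'j set \<Rightarrow> ('j \<Rightarrow> nat \<Rightarrow> complex) \<Rightarrow> ('j \<Rightarrow> complex) \<Rightarrow> complex mat" where
  "gram d J v y = mat d d (\<lambda>(a, b). \<Sum>i\<in>J. y i * (cnj (v i a) * v i b))"

lemma gram_carrier: "gram d J v y \<in> carrier_mat d d"
  by (simp add: gram_def)

lemma gram_mult:
  assumes "x \<in> carrier_vec d" "a < d"
  shows "vec_index (gram d J v y *\<^sub>v x) a = (\<Sum>i\<in>J. y i * (cnj (v i a) * pairing d (v i) (vec_index x)))"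
proof -
  have "vec_index (gram d J v y *\<^sub>v x) a = (\<Sum>b<d. (\<Sum>i\<in>J. y i * (cnj (v i a) * v i b)) * vec_index x b)"
    using assms by (simp add: gram_def scalar_prod_def lessThan_atLeast0)
  also have "\<dots> = (\<Sum>b<d. \<Sum>i\<in>J. y i * (cnj (v i a) * (v i b * vec_index x b)))"
    by (simp add: sum_distrib_right sum_distrib_left mult_ac)
  also have "\<dots> = (\<Sum>i\<in>J. y i * (cnj (v i a) * pairing d (v i) (vec_index x)))"
    unfolding pairing_def sum_distrib_left by (rule sum.swap)
  finally show ?thesis .
qed

lemma gram_form:
  "(\<Sum>a<d. cnj (x a) * (\<Sum>i\<in>J. y i * (cnj (v i a) * z i))) = (\<Sum>i\<in>J. y i * (cnj (pairing d (v i) x) * z i))"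
proof -
  have "(\<Sum>a<d. cnj (x a) * (\<Sum>i\<in>J. y i * (cnj (v i a) * z i)))
      = (\<Sum>a<d. \<Sum>i\<in>J. y i * (cnj (v i a * x a) * z i))"
    by (simp add: sum_distrib_left mult_ac)
  also have "\<dots> = (\<Sum>i\<in>J. \<Sum>a<d. y i * (cnj (v i a * x a) * z i))" by (rule sum.swap)
  also have "\<dots> = (\<Sum>i\<in>J. y i * (cnj (pairing d (v i) x) * z i))"
    by (simp add: pairing_def sum_distrib_left sum_distrib_right)
  finally show ?thesis .
qed

text \<open>A kernel vector, paired with its image. Vectors are functions of which only the first
  \<open>d\<close> coordinates count, so being nonzero is witnessed by a coordinate below
  \<open>d\<close>.\<close>

lemma det_gram_zeroD:
  assumes "det (gram d J v y) = 0"
  obtains x a where "a < d" "x a \<noteq> 0" "(\<Sum>i\<in>J. y i * of_real ((cmod (pairing d (v i) x))\<^sup>2)) = 0"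
proof -
  obtain x where x: "x \<in> carrier_vec d" "x \<noteq> 0\<^sub>v d" "gram d J v y *\<^sub>v x = 0\<^sub>v d"
    using assms det_0_iff_vec_prod_zero[OF gram_carrier] by blast
  obtain a where a: "a < d" "vec_index x a \<noteq> 0"
    using x(1,2) by (metis carrier_vecD eq_vecI index_zero_vec(1,2))
  have "(\<Sum>i\<in>J. y i * (cnj (v i b) * pairing d (v i) (vec_index x))) = 0" if "b < d" for b
    using gram_mult[OF x(1) that, of J v y] x(3) that by simp
  then have "(\<Sum>b<d. cnj (vec_index x b) * (\<Sum>i\<in>J. y i * (cnj (v i b) * pairing d (v i) (vec_index x)))) = 0"
    by simp
  then have "(\<Sum>i\<in>J. y i * of_real ((cmod (pairing d (v i) (vec_index x)))\<^sup>2)) = 0"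
    unfolding gram_form by (simp add: complex_norm_square mult.commute[of "cnj _"] del: of_real_power)
  with a show ?thesis by (rule that)
qed

lemma det_gram_zeroI:
  assumes "a < d" "x a \<noteq> 0"
    and "\<And>b. b < d \<Longrightarrow> (\<Sum>i\<in>J. y i * (cnj (v i b) * pairing d (v i) x)) = 0"
  shows "det (gram d J v y) = 0"
proof -
  have pairing: "pairing d (v i) (vec_index (vec d x)) = pairing d (v i) x" for i
    unfolding pairing_def by (intro sum.cong) auto
  have "gram d J v y *\<^sub>v vec d x = 0\<^sub>v d"
  proof (rule eq_vecI)
    fix b assume "b < dim_vec (0\<^sub>v d :: complex vec)"
    then have b: "b < d" by simp
    show "vec_index (gram d J v y *\<^sub>v vec d x) b = vec_index (0\<^sub>v d) b"
      using assms(3)[OF b] b by (subst gram_mult) (auto simp: pairing)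
  qed (simp add: gram_def)
  moreover have "vec d x \<noteq> 0\<^sub>v d" using assms(1,2) by (metis index_vec index_zero_vec(1))
  ultimately show ?thesis
    using det_0_iff_vec_prod_zero[OF gram_carrier, of d J v y] by (metis vec_carrier)
qed

text \<open>Changing one weight is a rank one update. At real weights the matrix is Hermitian, so
  conjugation amounts to transposition and the determinant is real.\<close>

lemma det_gram_maff:
  assumes "finite J"
  obtains c where "\<And>y. det (gram d J v y) = maff J c y"
proof (rule maff_exists[OF assms, of "\<lambda>y. det (gram d J v y)"])
  fix y :: "'a \<Rightarrow> complex" and i h assume i: "i \<in> J"
  have "gram d J v (y(i := h)) = mat d d (\<lambda>(a, b). gram d J v (y(i := 0)) $$ (a, b) + h * (cnj (v i a) * v i b))" for h
    unfolding gram_def using assms i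
    by (intro eq_matI) (auto simp: sum.remove[of J i] intro!: sum.cong)
  then show "det (gram d J v (y(i := h))) = det (gram d J v (y(i := 0))) +
      h * (det (gram d J v (y(i := 1))) - det (gram d J v (y(i := 0))))"
    using det_rank_one_affine[OF gram_carrier, of d J v "y(i := 0)", where u = "\<lambda>a. cnj (v i a)" and w = "v i" and h = h] by metis
next
  fix y y' :: "'a \<Rightarrow> complex" assume eq: "\<And>i. i \<in> J \<Longrightarrow> y i = y' i"
  show "det (gram d J v y) = det (gram d J v y')"
    unfolding gram_def by (intro arg_cong[of _ _ det] eq_matI) (auto intro!: sum.cong simp: eq)
next
  fix y :: "'a \<Rightarrow> complex" assume "\<And>i. y i = 0 \<or> y i = 1"
  then have y: "cnj (y i) = y i" for i by (metis complex_cnj_one complex_cnj_zero)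
  interpret cnj: comm_ring_hom cnj by unfold_locales auto
  have "cnj (det (gram d J v y)) = det (map_mat cnj (gram d J v y))" by simp
  also have "map_mat cnj (gram d J v y) = transpose_mat (gram d J v y)"
    by (intro eq_matI) (auto simp: gram_def y mult.commute)
  also have "det \<dots> = det (gram d J v y)" by (rule det_transpose[OF gram_carrier])
  finally show "det (gram d J v y) \<in> \<real>" by (simp add: Reals_cnj_iff)
qed (use that in blast)

subsection \<open>Halving\<close>

text \<open>First order optimality without derivatives: a small \<open>s\<close> of sign opposite to
  \<open>N\<close> makes the linear term win.\<close>

lemma linear_coeff_zero:
  fixes N F :: real
  assumes "\<And>s. 0 \<le> 2 * s * N + s\<^sup>2 * F"
  shows "N = 0"
proof (rule ccontr)
  assume N: "N \<noteq> 0"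
  define s where "s = - N / (\<bar>F\<bar> + 1)"
  have "s\<^sup>2 * F \<le> s\<^sup>2 * (\<bar>F\<bar> + 1)" by (intro mult_left_mono) auto
  also have "\<dots> = - s * N" by (simp add: s_def power2_eq_square)
  finally have "0 \<le> s * N" using assms[of s] by simp
  moreover have "s * N < 0"
    using N by (simp add: s_def divide_less_0_iff mult_less_0_iff add_nonneg_pos flip: power2_eq_square)
  ultimately show False by simp
qed

lemma pairing_cong: "(\<And>a. a < d \<Longrightarrow> x a = y a) \<Longrightarrow> pairing d v x = pairing d v y"
  unfolding pairing_def by (intro sum.cong) auto

lemma pairing_add: "pairing d v (\<lambda>a. x a + y a) = pairing d v x + pairing d v y"
  by (simp add: pairing_def algebra_simps sum.distrib)

lemma pairing_scale: "pairing d v (\<lambda>a. r * x a) = r * pairing d v x"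
  by (simp add: pairing_def algebra_simps sum_distrib_left)

text \<open>Fixing the coordinates from \<open>d\<close> on at 0 and confining the others to a disc
  makes the surrounding product compact by Tychonoff; the sphere is closed in it.\<close>

lemma compact_coordinate_sphere:
  "compact {x :: nat \<Rightarrow> complex. (\<forall>a. x a \<in> (if a < d then cball 0 1 else {0})) \<and> (\<Sum>a<d. (cmod (x a))\<^sup>2) = 1}"
proof -
  let ?C = "PiE UNIV (\<lambda>a. if a < d then cball 0 1 else {0 :: complex})"
  have "compactin (product_topology (\<lambda>_. euclidean) UNIV) ?C"
    by (subst compactin_PiE) auto
  then have C: "compact ?C"
    by (simp add: euclidean_product_topology compactin_euclidean_iff)
  have "continuous_on UNIV (\<lambda>x :: nat \<Rightarrow> complex. \<Sum>a<d. (cmod (x a))\<^sup>2)"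
    by (intro continuous_intros continuous_on_product_coordinates)
  then have "closed {x :: nat \<Rightarrow> complex. (\<Sum>a<d. (cmod (x a))\<^sup>2) = 1}"
    by (intro closed_Collect_eq continuous_on_const)
  from compact_Int_closed[OF C this] show ?thesis
    by (rule back_subst[of compact]) (auto simp: PiE_iff split: if_splits)
qed

text \<open>A maximizer of the quotient of the two forms is a kernel vector of the pencil at the maximum.\<close>

lemma form_le_of_det_nonzero:
  fixes \<rho> :: real and v :: "'j \<Rightarrow> nat \<Rightarrow> complex"
  assumes fin: "finite J" and S: "S \<subseteq> J"
    and pos: "\<And>x a. a < d \<Longrightarrow> x a \<noteq> 0 \<Longrightarrow> 0 < (\<Sum>i\<in>J. (cmod (pairing d (v i) x))\<^sup>2)"
    and nz: "\<And>r. \<rho> \<le> r \<Longrightarrow> det (gram d J v (\<lambda>i. of_real (r - (if i \<in> S then 2 else 0)))) \<noteq> 0"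
  shows "2 * (\<Sum>i\<in>S. (cmod (pairing d (v i) x))\<^sup>2) \<le> \<rho> * (\<Sum>i\<in>J. (cmod (pairing d (v i) x))\<^sup>2)"
proof (rule ccontr)
  assume neg: "\<not> ?thesis"
  define B where "B x = (\<Sum>i\<in>J. (cmod (pairing d (v i) x))\<^sup>2)" for x
  define T where "T x = 2 * (\<Sum>i\<in>S. (cmod (pairing d (v i) x))\<^sup>2)" for x
  define K where "K = {x :: nat \<Rightarrow> complex. (\<forall>a. x a \<in> (if a < d then cball 0 1 else {0})) \<and> (\<Sum>a<d. (cmod (x a))\<^sup>2) = 1}"
  have posK: "0 < B x" if "x \<in> K" for x
  proof -
    have "\<exists>a<d. x a \<noteq> 0"
    proof (rule ccontr)
      assume "\<not> (\<exists>a<d. x a \<noteq> 0)"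
      then have "(\<Sum>a<d. (cmod (x a))\<^sup>2) = 0" by simp
      then show False using that by (simp add: K_def)
    qed
    then show ?thesis unfolding B_def using pos by blast
  qed
  have zero: "B x = 0 \<and> T x = 0" if "\<And>a. a < d \<Longrightarrow> x a = 0" for x
    using that by (simp add: B_def T_def pairing_def)
  \<comment> \<open>Both forms are homogeneous, so the quotient can be maximized on the unit
    sphere.\<close>
  have norm: "\<exists>z\<in>K. \<exists>r\<ge>0. B x = r * B z \<and> T x = r * T z" if a: "a < d" "x a \<noteq> 0" for x a
  proof -
    define n where "n = (\<Sum>a<d. (cmod (x a))\<^sup>2)"
    have le: "(cmod (x b))\<^sup>2 \<le> n" if "b < d" for b
      unfolding n_def using that by (intro member_le_sum) auto
    have n: "0 < n"
    proof -
      have "0 < (cmod (x a))\<^sup>2" using a(2) by simp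
      also have "\<dots> \<le> n" by (rule le[OF a(1)])
      finally show ?thesis .
    qed
    define z where "z b = (if b < d then of_real (1 / sqrt n) * x b else 0)" for b
    have ipz: "pairing d u z = of_real (1 / sqrt n) * pairing d u x" for u
    proof -
      have "pairing d u z = pairing d u (\<lambda>b. of_real (1 / sqrt n) * x b)"
        by (rule pairing_cong) (simp add: z_def)
      then show ?thesis by (simp only: pairing_scale)
    qed
    have cz: "(cmod (z b))\<^sup>2 = (cmod (x b))\<^sup>2 / n" if "b < d" for b
      using that n by (simp add: z_def norm_divide power_divide)
    have "(\<Sum>b<d. (cmod (z b))\<^sup>2) = (\<Sum>b<d. (cmod (x b))\<^sup>2 / n)"
      by (intro sum.cong) (auto simp: cz)
    also have "\<dots> = 1" using n by (simp add: n_def flip: sum_divide_distrib)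
    finally have s: "(\<Sum>b<d. (cmod (z b))\<^sup>2) = 1" .
    have "cmod (z b) \<le> 1" if "b < d" for b
    proof (rule power2_le_imp_le)
      show "(cmod (z b))\<^sup>2 \<le> 1\<^sup>2" using cz[OF that] le[OF that] n by simp
    qed simp
    with s have "z \<in> K" by (auto simp: K_def z_def)
    moreover have "(cmod (pairing d u z))\<^sup>2 = (cmod (pairing d u x))\<^sup>2 / n" for u
      unfolding ipz using n by (simp add: norm_divide power_divide)
    then have "B x = n * B z" "T x = n * T z"
      unfolding B_def T_def using n by (simp_all flip: sum_divide_distrib)
    ultimately show ?thesis using n by (intro bexI[of _ z] exI[of _ n]) auto
  qed
  have nx: "\<rho> * B x < T x" using neg by (simp add: B_def T_def)
  then obtain a where "a < d" "x a \<noteq> 0" using zero[of x] by force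
  from norm[where x = x and a = a, OF this] obtain z0 r0 where z0: "z0 \<in> K" "0 \<le> r0" "B x = r0 * B z0" "T x = r0 * T z0" by blast
  have z0': "\<rho> * B z0 < T z0"
  proof (rule ccontr)
    assume "\<not> ?thesis"
    then have "r0 * T z0 \<le> r0 * (\<rho> * B z0)" using z0(2) by (intro mult_left_mono) auto
    with nx z0 show False by (simp add: mult_ac)
  qed
  have contip: "continuous_on X (\<lambda>x. pairing d u x)" for X u
    unfolding pairing_def by (intro continuous_intros continuous_on_product_coordinates
        continuous_on_subset[OF _ subset_UNIV])
  have "continuous_on K (\<lambda>x. T x / B x)"
    unfolding T_def B_def using posK unfolding B_def
    by (intro continuous_intros contip) force
  moreover have "compact K" unfolding K_def by (rule compact_coordinate_sphere)
  ultimately obtain w where w: "w \<in> K" "\<And>x. x \<in> K \<Longrightarrow> T x / B x \<le> T w / B w"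
    using continuous_attains_sup[of K "\<lambda>x. T x / B x"] z0(1) by blast
  define r where "r = T w / B w"
  have "\<rho> < T z0 / B z0" using z0' posK[OF z0(1)] by (simp add: field_simps)
  also have "\<dots> \<le> r" unfolding r_def by (rule w(2)[OF z0(1)])
  finally have r: "\<rho> < r" .
  define y where "y i = r - (if i \<in> S then 2 else 0)" for i
  define F where "F x = (\<Sum>i\<in>J. y i * (cmod (pairing d (v i) x))\<^sup>2)" for x
  have F: "F x = r * B x - T x" for x
  proof -
    have "F x = (\<Sum>i\<in>J. r * (cmod (pairing d (v i) x))\<^sup>2 - (if i \<in> S then 2 * (cmod (pairing d (v i) x))\<^sup>2 else 0))"
      unfolding F_def y_def by (intro sum.cong) (auto simp: algebra_simps)
    also have "\<dots> = r * B x - T x"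
      unfolding B_def T_def sum_subtractf sum_distrib_left
      using S fin by (simp add: sum.inter_restrict[symmetric] inf.absorb2)
    finally show ?thesis .
  qed
  have Fnn: "0 \<le> F x" for x
  proof (cases "\<exists>a<d. x a \<noteq> 0")
    case True
    then obtain z s where z: "z \<in> K" "0 \<le> s" "B x = s * B z" "T x = s * T z" using norm by blast
    have "T z \<le> r * B z" using w(2)[OF z(1)] posK[OF z(1)] by (simp add: r_def field_simps)
    then have "s * T z \<le> s * (r * B z)" using z(2) by (rule mult_left_mono)
    then show ?thesis unfolding F z by (simp add: mult_ac)
  qed (use zero[of x] F in auto)
  have Fw: "F w = 0" unfolding F r_def using posK[OF w(1)] by simp
  \<comment> \<open>The pencil at the maximum \<open>r\<close>, applied to the maximizer
    \<open>w\<close>; the goal is that \<open>g\<close> vanishes.\<close>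
  define g where "g a = (\<Sum>i\<in>J. of_real (y i) * (cnj (v i a) * pairing d (v i) w))" for a
  have Re: "(\<Sum>i\<in>J. y i * Re (cnj (pairing d (v i) g) * pairing d (v i) w)) = (\<Sum>a<d. (cmod (g a))\<^sup>2)"
  proof -
    have "(\<Sum>i\<in>J. of_real (y i) * (cnj (pairing d (v i) g) * pairing d (v i) w)) = (\<Sum>a<d. cnj (g a) * g a)"
      unfolding gram_form[symmetric] by (simp only: g_def)
    also have "\<dots> = of_real (\<Sum>a<d. (cmod (g a))\<^sup>2)"
      by (simp add: complex_norm_square mult.commute del: of_real_power)
    finally have "Re (\<Sum>i\<in>J. of_real (y i) * (cnj (pairing d (v i) g) * pairing d (v i) w)) = (\<Sum>a<d. (cmod (g a))\<^sup>2)"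
      by simp
    then show ?thesis by simp
  qed
  \<comment> \<open>Perturbing \<open>w\<close> in the direction \<open>g\<close> itself makes the
    linear coefficient the squared length of \<open>g\<close>.\<close>
  have exp: "F (\<lambda>a. w a + of_real s * g a) = 2 * s * (\<Sum>a<d. (cmod (g a))\<^sup>2) + s\<^sup>2 * F g" for s
  proof -
    have "(cmod (pairing d u (\<lambda>a. w a + of_real s * g a)))\<^sup>2
       = (cmod (pairing d u w))\<^sup>2 + 2 * s * Re (cnj (pairing d u g) * pairing d u w) + s\<^sup>2 * (cmod (pairing d u g))\<^sup>2" for u
      unfolding pairing_add pairing_scale cmod_power2 by (simp add: power2_eq_square algebra_simps)
    then have "F (\<lambda>a. w a + of_real s * g a) = F w + 2 * s * (\<Sum>i\<in>J. y i * Re (cnj (pairing d (v i) g) * pairing d (v i) w)) + s\<^sup>2 * F g"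
      unfolding F_def by (simp add: distrib_left sum.distrib sum_distrib_left mult_ac)
    then show ?thesis using Fw Re by simp
  qed
  have "(\<Sum>a<d. (cmod (g a))\<^sup>2) = 0"
    by (rule linear_coeff_zero[of _ "F g"]) (use Fnn in \<open>simp flip: exp\<close>)
  then have g0: "g b = 0" if "b < d" for b
    using that by (simp add: sum_nonneg_eq_0_iff)
  obtain a where "a < d" "w a \<noteq> 0"
    using posK[OF w(1)] zero[of w] by force
  then have "det (gram d J v (\<lambda>i. of_real (y i))) = 0"
    by (rule det_gram_zeroI) (use g0 in \<open>simp add: g_def\<close>)
  with nz[of r] r show False by (simp add: y_def)
qed

text \<open>\<open>small\<close> bounds all barriers at a constant starting point;
  \<open>above_mixes\<close> bounds the diagonal roots of the averaged product,
  \<open>exists_translates\<close> picks a partition, and \<open>form_le_of_det_nonzero\<close>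
  turns the root bound into inequalities between forms.\<close>

lemma halving:
  fixes v :: "'j \<Rightarrow> nat \<Rightarrow> complex" and \<epsilon> :: real
  assumes fin: "finite J"
    and pos: "\<And>x a. a < d \<Longrightarrow> x a \<noteq> 0 \<Longrightarrow> 0 < (\<Sum>i\<in>J. (cmod (pairing d (v i) x))\<^sup>2)"
    and small: "\<And>j x. j \<in> J \<Longrightarrow> (cmod (pairing d (v j) x))\<^sup>2 \<le> \<epsilon> * (\<Sum>i\<in>J. (cmod (pairing d (v i) x))\<^sup>2)"
    and \<epsilon>: "0 < \<epsilon>" "\<epsilon> \<le> 1/8"
  obtains S where "S \<subseteq> J"
    "\<And>x. 2 * (\<Sum>i\<in>S. (cmod (pairing d (v i) x))\<^sup>2) \<le> (1 + 3 * sqrt (2 * \<epsilon>)) * (\<Sum>i\<in>J. (cmod (pairing d (v i) x))\<^sup>2)"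
    "\<And>x. 2 * (\<Sum>i\<in>J - S. (cmod (pairing d (v i) x))\<^sup>2) \<le> (1 + 3 * sqrt (2 * \<epsilon>)) * (\<Sum>i\<in>J. (cmod (pairing d (v i) x))\<^sup>2)"
proof -
  let ?I = "J \<times> (UNIV :: bool set)"
  have fI: "finite ?I" using fin by simp
  obtain cD where cD: "\<And>y. det (gram d J v y) = maff J cD y" using det_gram_maff[OF fin] by blast
  \<comment> \<open>One argument for two uses: \<open>g = Im\<close> gives stability,
    \<open>g = Re\<close> gives nonvanishing at positive real weights.\<close>
  have nz: "maff J cD y \<noteq> 0" if y: "\<And>i. i \<in> J \<Longrightarrow> 0 < g (y i)"
    and g: "\<And>x::nat\<Rightarrow>complex. g (\<Sum>i\<in>J. y i * of_real ((cmod (pairing d (v i) x))\<^sup>2)) = (\<Sum>i\<in>J. g (y i) * (cmod (pairing d (v i) x))\<^sup>2)"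
    and g0: "g 0 = 0" for y and g :: "complex \<Rightarrow> real"
  proof
    assume "maff J cD y = 0"
    then obtain x a where x: "a < d" "x a \<noteq> 0" "(\<Sum>i\<in>J. y i * of_real ((cmod (pairing d (v i) x))\<^sup>2)) = 0"
      using det_gram_zeroD[of d J v y] unfolding cD by blast
    have "(\<Sum>i\<in>J. g (y i) * (cmod (pairing d (v i) x))\<^sup>2) = 0" using g[of x] x(3) g0 by simp
    then have "\<forall>i\<in>J. g (y i) * (cmod (pairing d (v i) x))\<^sup>2 = 0"
      using y fin by (subst (asm) sum_nonneg_eq_0_iff) (auto simp: less_imp_le)
    then have "(\<Sum>i\<in>J. (cmod (pairing d (v i) x))\<^sup>2) = 0" using y by (intro sum.neutral) force
    with pos[where x = x and a = a, OF x(1,2)] show False by simp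
  qed
  have nzI: "maff J cD y \<noteq> 0" if "\<And>i. i \<in> J \<Longrightarrow> 0 < Im (y i)" for y
    by (rule nz[of Im]) (use that in auto)
  have nzR: "maff J cD y \<noteq> 0" if "\<And>i. i \<in> J \<Longrightarrow> 0 < y i" for y :: "'j \<Rightarrow> real"
  proof -
    have "maff J cD (\<lambda>i. complex_of_real (y i)) \<noteq> 0"
      by (rule nz[of Re]) (use that in auto)
    then show ?thesis unfolding of_real_maff[symmetric] by simp
  qed
  define P where "P y = maff J cD (\<lambda>j. y (j, False)) * maff J cD (\<lambda>j. y (j, True))" for y :: "'j \<times> bool \<Rightarrow> complex"
  obtain c where c: "\<And>y. P y = maff ?I c y"
  proof (rule maff_exists[OF fI, of P])
    fix y :: "'j \<times> bool \<Rightarrow> complex" and i h assume "i \<in> ?I"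
    then obtain j b where i: "i = (j, b)" "j \<in> J" by auto
    define G where "G b' h = maff J cD (\<lambda>k. (y(i := h)) (k, b'))" for b' h
    have upd: "(\<lambda>k. (y(i := h)) (k, b')) = (if b' = b then (\<lambda>k. y (k, b))(j := h) else (\<lambda>k. y (k, b')))" for h b'
      using i by auto
    have G: "G b h = G b 0 + h * (G b 1 - G b 0)"
      unfolding G_def upd
      using maff_upd[OF fin i(2), of cD "(\<lambda>k. y (k, b))(j := 0)" h]
        maff_upd[OF fin i(2), of cD "(\<lambda>k. y (k, b))(j := 0)" 1] by simp
    have Gn: "G (\<not> b) h = G (\<not> b) h'" for h h' unfolding G_def upd by simp
    have PG: "P (y(i := h)) = G b h * G (\<not> b) 0" for h
      unfolding Gn[of 0 h] unfolding P_def G_def by (cases b) simp_all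
    show "P (y(i := h)) = P (y(i := 0)) + h * (P (y(i := 1)) - P (y(i := 0)))"
      unfolding PG by (subst G) (simp add: algebra_simps)
  next
    fix y y' :: "'j \<times> bool \<Rightarrow> complex" assume "\<And>i. i \<in> ?I \<Longrightarrow> y i = y' i"
    then show "P y = P y'" unfolding P_def by (intro arg_cong2[where f="(*)"] maff_cong) auto
  next
    fix y :: "'j \<times> bool \<Rightarrow> complex" assume y: "\<And>i. y i = 0 \<or> y i = 1"
    define z where "z i = Re (y i)" for i
    have z: "y = (\<lambda>i. of_real (z i))"
    proof
      show "y i = of_real (z i)" for i using y[of i] by (auto simp: z_def)
    qed
    have "P y = of_real (maff J cD (\<lambda>j. z (j, False)) * maff J cD (\<lambda>j. z (j, True)))"
      unfolding P_def z of_real_mult of_real_maff ..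
    then show "P y \<in> \<real>" by simp
  qed blast
  have cr: "maff ?I c y = maff J cD (\<lambda>j. y (j, False)) * maff J cD (\<lambda>j. y (j, True))" for y :: "'j \<times> bool \<Rightarrow> real"
  proof -
    have "complex_of_real (maff ?I c y) = of_real (maff J cD (\<lambda>j. y (j, False)) * maff J cD (\<lambda>j. y (j, True)))"
      unfolding of_real_mult of_real_maff c[symmetric] P_def ..
    then show ?thesis by (simp only: of_real_eq_iff)
  qed
  have st: "hstable ?I c" unfolding hstable_def c[symmetric] P_def by (auto intro!: nzI)
  \<comment> \<open>The determinant has no zero on the convex positive orthant, so its sign is
    constant there and the product of two values is positive.\<close>
  have same_sign: "0 < maff J cD y * maff J cD y'" if "\<And>i. i \<in> J \<Longrightarrow> 0 < y i" "\<And>i. i \<in> J \<Longrightarrow> 0 < y' i" for y y' :: "'j \<Rightarrow> real"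
  proof (rule ccontr)
    assume neg: "\<not> ?thesis"
    define g where "g t = maff J cD y * maff J cD (\<lambda>i. (1 - t) * y i + t * y' i)" for t
    have "continuous_on {0..1} g" unfolding g_def by (intro continuous_intros)
    moreover have "0 \<le> g 0" "g 1 \<le> 0" using neg by (auto simp: g_def)
    ultimately obtain t where t: "0 \<le> t" "t \<le> 1" "g t = 0" using IVT2'[of g 1 0 0] by auto
    have "0 < (1 - t) * y i + t * y' i" if "i \<in> J" for i
      using \<open>\<And>i. i \<in> J \<Longrightarrow> 0 < y i\<close>[OF that] \<open>\<And>i. i \<in> J \<Longrightarrow> 0 < y' i\<close>[OF that] t
      by (cases "t = 0") (auto intro: add_nonneg_pos)
    then have "g t \<noteq> 0" unfolding g_def using nzR that by simp
    with t show False by simp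
  qed
  \<comment> \<open>With this choice the two barriers of an index add up to at most 2 * \<epsilon> /
    q = q, so \<open>q\<close> is both the starting point and the barrier bound.\<close>
  define q where "q = sqrt (2 * \<epsilon>)"
  have q: "0 < q" "q\<^sup>2 = 2 * \<epsilon>" using \<epsilon> by (auto simp: q_def)
  have "q \<le> sqrt ((1/2)\<^sup>2)" unfolding q_def using \<epsilon> by (intro real_sqrt_le_mono) (simp add: power2_eq_square)
  then have q2: "q \<le> 1/2" by simp
  have ab: "above ?I c (\<lambda>_. q)"
    unfolding above_def cr using q(1) by (auto intro!: same_sign intro: less_le_trans)
  \<comment> \<open>The inverse barrier is the distance to the zero below \<open>q\<close> in this
    coordinate. A kernel vector at that zero would contradict \<open>small\<close> if the distance
    were less than q / \<epsilon>.\<close>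
  have bar: "barrier ?I c (j, b) (\<lambda>_. q) \<le> \<epsilon> / q" if j: "j \<in> J" for j b
  proof (rule ccontr)
    assume neg: "\<not> ?thesis"
    define A where "A = maff ?I c (\<lambda>_. q)"
    define B where "B = maff ?I (dcoeff (j, b) c) (\<lambda>_. q)"
    have A: "0 < A" using ab by (auto simp: above_def A_def)
    have BA: "\<epsilon> / q < B / A" using neg by (simp add: barrier_def A_def B_def)
    moreover have "0 < \<epsilon> / q" using \<epsilon> q by simp
    ultimately have B: "0 < B" using A by (metis less_trans zero_less_divide_iff less_asym)
    define h where "h = - A / B"
    have m: "(j, b) \<in> ?I" using j by simp
    define z where "z = (\<lambda>_. q)((j, b) := q + h)"
    have z0: "maff ?I c z = 0"
      unfolding z_def
      using maff_upd[OF fI m, of c "\<lambda>_. q" h] B by (simp add: A_def[symmetric] B_def[symmetric] h_def)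
    have sl: "(\<lambda>k. z (k, b')) = (if b' = b then (\<lambda>_. q)(j := q + h) else (\<lambda>_. q))" for b'
      by (auto simp: z_def)
    have "maff J cD (\<lambda>_. q) \<noteq> 0" by (rule nzR) (rule q(1))
    then have "maff J cD ((\<lambda>_. q)(j := q + h)) = 0"
      using z0 unfolding cr sl by (cases b) simp_all
    then have "det (gram d J v (\<lambda>i. of_real (((\<lambda>_. q)(j := q + h)) i))) = 0"
      unfolding cD of_real_maff[symmetric] by (simp only: of_real_0)
    then obtain x a where x: "a < d" "x a \<noteq> 0"
      "(\<Sum>i\<in>J. of_real (((\<lambda>_. q)(j := q + h)) i) * complex_of_real ((cmod (pairing d (v i) x))\<^sup>2)) = 0"
      by (rule det_gram_zeroD)
    define Q where "Q = (\<Sum>i\<in>J. (cmod (pairing d (v i) x))\<^sup>2)"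
    have Q: "0 < Q" unfolding Q_def by (rule pos[where x = x and a = a, OF x(1,2)])
    have "complex_of_real (\<Sum>i\<in>J. ((\<lambda>_. q)(j := q + h)) i * (cmod (pairing d (v i) x))\<^sup>2) = 0"
      using x(3) by simp
    then have "(\<Sum>i\<in>J. ((\<lambda>_. q)(j := q + h)) i * (cmod (pairing d (v i) x))\<^sup>2) = 0"
      by (simp only: of_real_eq_0_iff)
    moreover have "(\<Sum>i\<in>J. ((\<lambda>_. q)(j := q + h)) i * (cmod (pairing d (v i) x))\<^sup>2) = q * Q + h * (cmod (pairing d (v j) x))\<^sup>2"
      unfolding Q_def sum_distrib_left using fin j
      by (subst (1 2) sum.remove[of J j]) (auto simp: algebra_simps intro!: sum.cong)
    ultimately have "q * Q = A / B * (cmod (pairing d (v j) x))\<^sup>2" by (simp add: h_def)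
    also have "\<dots> \<le> A / B * (\<epsilon> * Q)"
      unfolding Q_def using A B j by (intro mult_left_mono small) auto
    finally have "q * Q \<le> (A / B * \<epsilon>) * Q" by (simp only: mult.assoc)
    then have "q \<le> A / B * \<epsilon>" using Q by (rule mult_right_le_imp_le)
    with BA A B q show False by (simp add: field_simps)
  qed
  obtain js where js: "set js = J" "distinct js" using finite_distinct_list[OF fin] by blast
  have q1: "q < 1" using q2 by simp
  define \<delta> where "\<delta> = 1 / (1 - q)"
  have bar2: "barrier ?I c (j, False) (\<lambda>_. q) + barrier ?I c (j, True) (\<lambda>_. q) \<le> q" if "j \<in> set js" for j
  proof -
    have "barrier ?I c (j, False) (\<lambda>_. q) + barrier ?I c (j, True) (\<lambda>_. q) \<le> \<epsilon> / q + \<epsilon> / q"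
      using that js by (intro add_mono bar) auto
    also have "\<dots> = q" using q by (simp add: field_simps power2_eq_square)
    finally show ?thesis .
  qed
  have sub: "set js \<subseteq> J" using js by simp
  define \<rho> where "\<rho> = 1 + 3 * q"
  \<comment> \<open>This amounts to q <= 1/2, hence the hypothesis \<epsilon> <= 1/8. The end point
    q + \<delta> is then at most 1 + 3 * q.\<close>
  have "\<delta> \<le> 1 + 2 * q"
  proof -
    have "1 \<le> (1 + 2 * q) * (1 - q)" using q q2 mult_left_mono[OF q2, of "2 * q"] by (simp add: algebra_simps)
    then show ?thesis unfolding \<delta>_def using q1 by (simp add: pos_divide_le_eq)
  qed
  then have "0 < maff ?I (mixes js c) (\<lambda>_. r)" if "\<rho> \<le> r" for r
    using above_mixes[OF fin q1 \<delta>_def st ab sub js(2) bar2] that js(1) q(1)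
    unfolding above_def \<rho>_def by auto
  from exists_translates[OF fin q1 st ab sub js(2) bar2 this]
  obtain h where h: "\<And>r. \<rho> \<le> r \<Longrightarrow> 0 < maff ?I (translates h js c) (\<lambda>_. r)" by blast
  define S where "S = {j \<in> J. \<not> h j}"
  have tr: "maff ?I (translates h js c) (\<lambda>_. r)
      = maff J cD (\<lambda>j. r - (if j \<in> S then 2 else 0)) * maff J cD (\<lambda>j. r - (if j \<in> J - S then 2 else 0))" for r :: real
    unfolding maff_translates[OF fin sub js(2)] cr
    by (intro arg_cong2[where f="(*)"] maff_cong) (auto simp: S_def js(1))
  have nzS: "det (gram d J v (\<lambda>i. of_real (r - (if i \<in> S' then 2 else 0)))) \<noteq> 0"
    if "\<rho> \<le> r" "S' = S \<or> S' = J - S" for r S'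
  proof -
    have "maff J cD (\<lambda>j. r - (if j \<in> S' then 2 else 0)) \<noteq> 0"
      using h[OF that(1)] that(2) unfolding tr by auto
    then show ?thesis unfolding cD of_real_maff[symmetric] by simp
  qed
  have S: "S \<subseteq> J" by (auto simp: S_def)
  show ?thesis
  proof (rule that[OF S])
    show "2 * (\<Sum>i\<in>S. (cmod (pairing d (v i) x))\<^sup>2) \<le> (1 + 3 * sqrt (2 * \<epsilon>)) * (\<Sum>i\<in>J. (cmod (pairing d (v i) x))\<^sup>2)" for x
      using form_le_of_det_nonzero[where x = x, OF fin S pos nzS] by (simp add: \<rho>_def q_def)
    show "2 * (\<Sum>i\<in>J - S. (cmod (pairing d (v i) x))\<^sup>2) \<le> (1 + 3 * sqrt (2 * \<epsilon>)) * (\<Sum>i\<in>J. (cmod (pairing d (v i) x))\<^sup>2)" for x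
      using form_le_of_det_nonzero[where S = "J - S" and x = x, OF fin _ pos nzS] by (simp add: \<rho>_def q_def)
  qed
qed

text \<open>The error terms of successive halvings grow geometrically, so that one bound of the shape
  \<open>45 * sqrt (r / T)\<close> survives a halving of \<open>T\<close>.\<close>

lemma halving_sqrt_bounds:
  fixes r T :: real
  assumes r: "0 < r" and T: "32400 * r \<le> T"
  defines "s \<equiv> sqrt (r / T)"
  shows "1/2 - 45 * sqrt (r / (T / 2)) \<le> (1 - 9 * s) * (1/2 - 45 * s)"
    and "(1 + 9 * s) * (3/2 + 45 * s) \<le> 3/2 + 45 * sqrt (r / (T / 2))"
    and "45 * s \<le> 1/4" and "3 * sqrt (2 * (4 * r / T)) \<le> 9 * s"
proof -
  have T0: "0 < T" using r T by linarith
  have s0: "0 \<le> s" using r T0 by (simp add: s_def)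
  have "s \<le> sqrt ((1/180)\<^sup>2)"
    unfolding s_def using T T0 by (intro real_sqrt_le_mono) (simp add: field_simps power2_eq_square)
  then have s1: "180 * s \<le> 1" by simp
  have "sqrt (r / (T / 2)) = sqrt 2 * s"
    unfolding s_def real_sqrt_mult[symmetric] by simp
  \<comment> \<open>Halving \<open>T\<close> raises the allowed error from 45 s to at least 63 s,
    while the losses require at most 49.5 s below and 60.75 s above.\<close>
  moreover have "1.4 \<le> sqrt (2::real)" by (rule real_le_rsqrt) (simp add: power2_eq_square)
  then have "1.4 * s \<le> sqrt 2 * s" using s0 by (rule mult_right_mono)
  ultimately have s2: "1.4 * s \<le> sqrt (r / (T / 2))" by simp
  have ss: "s * s \<le> s / 180" using mult_left_mono[OF s1 s0] by simp
  show "45 * s \<le> 1/4" using s1 by simp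
  have "(1 - 9 * s) * (1/2 - 45 * s) = 1/2 - 99/2 * s + 405 * (s * s)"
    by (simp add: algebra_simps)
  moreover have "0 \<le> s * s" by simp
  ultimately show "1/2 - 45 * sqrt (r / (T / 2)) \<le> (1 - 9 * s) * (1/2 - 45 * s)"
    using s2 s0 by linarith
  have "(1 + 9 * s) * (3/2 + 45 * s) = 3/2 + 117/2 * s + 405 * (s * s)"
    by (simp add: algebra_simps)
  then show "(1 + 9 * s) * (3/2 + 45 * s) \<le> 3/2 + 45 * sqrt (r / (T / 2))"
    using s2 s0 ss by linarith
  have "sqrt (2 * (4 * r / T)) = sqrt 8 * s"
    unfolding s_def real_sqrt_mult[symmetric] by simp
  moreover have "sqrt 8 \<le> (3::real)" by (rule real_le_lsqrt) auto
  then have "sqrt 8 * s \<le> 3 * s" using s0 by (rule mult_right_mono)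
  ultimately show "3 * sqrt (2 * (4 * r / T)) \<le> 9 * s" by linarith
qed

section \<open>Iterated halving down to the stopping size\<close>

lemma pairing_Cauchy_Schwarz:
  "(cmod (pairing d v x))\<^sup>2 \<le> (\<Sum>a<d. (cmod (v a))\<^sup>2) * (\<Sum>a<d. (cmod (x a))\<^sup>2)"
proof -
  have "cmod (pairing d v x) \<le> (\<Sum>a<d. cmod (v a) * cmod (x a))"
    unfolding pairing_def by (rule order_trans[OF norm_sum]) (simp add: norm_mult)
  then have "(cmod (pairing d v x))\<^sup>2 \<le> (\<Sum>a<d. cmod (v a) * cmod (x a))\<^sup>2"
    by (rule power_mono) simp
  also have "\<dots> \<le> (\<Sum>a<d. (cmod (v a))\<^sup>2) * (\<Sum>a<d. (cmod (x a))\<^sup>2)"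
    by (rule Cauchy_Schwarz_ineq_sum)
  finally show ?thesis .
qed

text \<open>The forms are measured against the nominal size, which halves exactly, and not against
  the cardinality, which is only known to stay below it.\<close>

lemma iterated_halving:
  fixes v :: "'j \<Rightarrow> nat \<Rightarrow> complex" and r T :: real
  assumes fin: "finite J" and r: "0 < r"
    and bd: "\<And>j. j \<in> J \<Longrightarrow> (\<Sum>a<d. (cmod (v j a))\<^sup>2) \<le> r"
    and card: "real (card J) \<le> T"
    and low: "\<And>x. 1/2 * T * (\<Sum>a<d. (cmod (x a))\<^sup>2) \<le> (\<Sum>i\<in>J. (cmod (pairing d (v i) x))\<^sup>2)"
    and up: "\<And>x. (\<Sum>i\<in>J. (cmod (pairing d (v i) x))\<^sup>2) \<le> 3/2 * T * (\<Sum>a<d. (cmod (x a))\<^sup>2)"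
  shows "32400 * r \<le> T / 2 ^ k \<Longrightarrow> \<exists>S\<subseteq>J. real (card S) \<le> T / 2 ^ k \<and>
    (\<forall>x. T / 2 ^ k * (1/2 - 45 * sqrt (r / (T / 2 ^ k))) * (\<Sum>a<d. (cmod (x a))\<^sup>2)
      \<le> (\<Sum>i\<in>S. (cmod (pairing d (v i) x))\<^sup>2)) \<and>
    (\<forall>x. (\<Sum>i\<in>S. (cmod (pairing d (v i) x))\<^sup>2)
      \<le> T / 2 ^ k * (3/2 + 45 * sqrt (r / (T / 2 ^ k))) * (\<Sum>a<d. (cmod (x a))\<^sup>2))"
proof (induction k)
  case 0
  have T: "0 < T" using r 0 by simp
  have s: "0 \<le> sqrt (r / T)" using T r by simp
  have "T * (1/2 - 45 * sqrt (r / T)) * n \<le> 1/2 * T * n \<and> 3/2 * T * n \<le> T * (3/2 + 45 * sqrt (r / T)) * n" if "0 \<le> n" for n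
    using that T s by (auto simp: algebra_simps)
  from order_trans[OF conjunct1[OF this] low] order_trans[OF up conjunct2[OF this]] show ?case
    using card by (intro exI[of _ J]) (simp add: sum_nonneg)
next
  case (Suc k)
  define T' where "T' = T / 2 ^ k"
  have T2: "T / 2 ^ Suc k = T' / 2" by (simp add: T'_def)
  have T': "32400 * r \<le> T'" "0 < T'" using Suc.prems r unfolding T2 by linarith+
  define n2 where "n2 x = (\<Sum>a<d. (cmod (x a))\<^sup>2)" for x :: "nat \<Rightarrow> complex"
  define Q where "Q S x = (\<Sum>i\<in>S. (cmod (pairing d (v i) x))\<^sup>2)" for S x
  define s where "s = sqrt (r / T')"
  obtain S where S: "S \<subseteq> J" "real (card S) \<le> T'"
    and lo: "\<And>x. T' * (1/2 - 45 * s) * n2 x \<le> Q S x"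
    and hi: "\<And>x. Q S x \<le> T' * (3/2 + 45 * s) * n2 x"
    using Suc.IH T'(1) unfolding T'_def[symmetric] n2_def[symmetric] Q_def[symmetric] s_def[symmetric] by blast
  have finS: "finite S" using S(1) fin finite_subset by blast
  note bounds = halving_sqrt_bounds[OF r T'(1), folded s_def]
  have n2: "0 \<le> n2 x" for x by (simp add: n2_def sum_nonneg)
  have s0: "0 \<le> s" using r T' by (simp add: s_def)
  have quarter: "T' / 4 * n2 x \<le> Q S x" for x
  proof -
    have "T' * (1/4) * n2 x \<le> T' * (1/2 - 45 * s) * n2 x"
      using bounds(3) T' n2 by (intro mult_right_mono mult_left_mono) auto
    with lo[of x] show ?thesis by simp
  qed
  \<comment> \<open>Each summand is at most \<open>r\<close> and the current form at least T' / 4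
    times the squared length, which gives this ratio.\<close>
  define \<epsilon> where "\<epsilon> = 4 * r / T'"
  have \<epsilon>: "0 < \<epsilon>" "\<epsilon> \<le> 1/8" using r T' by (auto simp: \<epsilon>_def field_simps)
  have pos: "0 < Q S x" if "a < d" "x a \<noteq> 0" for x a
  proof -
    have "0 < (cmod (x a))\<^sup>2" using that by simp
    also have "\<dots> \<le> n2 x" unfolding n2_def using that by (intro member_le_sum) auto
    finally have "0 < T' / 4 * n2 x" using T' by simp
    also note quarter
    finally show ?thesis .
  qed
  have small: "(cmod (pairing d (v j) x))\<^sup>2 \<le> \<epsilon> * Q S x" if "j \<in> S" for j x
  proof -
    have "(cmod (pairing d (v j) x))\<^sup>2 \<le> (\<Sum>a<d. (cmod (v j a))\<^sup>2) * n2 x"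
      unfolding n2_def by (rule pairing_Cauchy_Schwarz)
    also have "\<dots> \<le> r * n2 x" using that S(1) bd n2 by (intro mult_right_mono) auto
    also have "\<dots> = \<epsilon> * (T' / 4 * n2 x)" using T' by (simp add: \<epsilon>_def)
    also have "\<dots> \<le> \<epsilon> * Q S x" using quarter \<epsilon> by (intro mult_left_mono) auto
    finally show ?thesis .
  qed
  obtain A where A: "A \<subseteq> S" "\<And>x. 2 * Q A x \<le> (1 + 3 * sqrt (2 * \<epsilon>)) * Q S x"
    "\<And>x. 2 * Q (S - A) x \<le> (1 + 3 * sqrt (2 * \<epsilon>)) * Q S x"
  proof (rule halving[of S d v \<epsilon>])
    fix x :: "nat \<Rightarrow> complex" and a assume "a < d" "x a \<noteq> 0"
    then show "0 < (\<Sum>i\<in>S. (cmod (pairing d (v i) x))\<^sup>2)" unfolding Q_def[symmetric] by (rule pos)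
  next
    fix j x assume "j \<in> S"
    then show "(cmod (pairing d (v j) x))\<^sup>2 \<le> \<epsilon> * (\<Sum>i\<in>S. (cmod (pairing d (v i) x))\<^sup>2)"
      unfolding Q_def[symmetric] by (rule small)
  qed (use finS \<epsilon> in \<open>simp_all add: Q_def\<close>)
  have Q0: "0 \<le> Q S x" for x by (simp add: Q_def sum_nonneg)
  have split: "Q S x = Q A x + Q (S - A) x" for x
    unfolding Q_def using sum.subset_diff[OF A(1) finS, of "\<lambda>i. (cmod (pairing d (v i) x))\<^sup>2"] by simp
  \<comment> \<open>The lower bound for one part is the whole minus the upper bound for the
    other.\<close>
  have half: "(1 - 9 * s) * Q S x \<le> 2 * Q B x \<and> 2 * Q B x \<le> (1 + 9 * s) * Q S x" if "B = A \<or> B = S - A" for B x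
  proof -
    have "(1 + 3 * sqrt (2 * \<epsilon>)) * Q S x \<le> (1 + 9 * s) * Q S x"
      using bounds(4) Q0 by (intro mult_right_mono) (auto simp: \<epsilon>_def)
    then show ?thesis using A(2)[of x] A(3)[of x] split[of x] that by (auto simp: algebra_simps)
  qed
  have "card S = card A + card (S - A)"
    using A(1) finS by (metis card_Diff_subset card_mono finite_subset le_add_diff_inverse)
  \<comment> \<open>The smaller part is kept, so that the cardinality is at least halved as
    well.\<close>
  then obtain B where B: "B = A \<or> B = S - A" "2 * card B \<le> card S"
    by (metis add_le_cancel_left add_le_cancel_right linorder_le_cases mult_2)
  have "real (card B) \<le> T' / 2" using B(2) S(2) by linarith
  moreover have "T' / 2 * (1/2 - 45 * sqrt (r / (T' / 2))) * n2 x \<le> Q B x" for x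
  proof -
    have "T' * (1/2 - 45 * sqrt (r / (T' / 2))) * n2 x \<le> T' * ((1 - 9 * s) * (1/2 - 45 * s)) * n2 x"
      using bounds(1) T' n2 by (intro mult_right_mono mult_left_mono) auto
    also have "\<dots> = (1 - 9 * s) * (T' * (1/2 - 45 * s) * n2 x)" by simp
    also have "\<dots> \<le> (1 - 9 * s) * Q S x" using lo bounds(3) by (intro mult_left_mono) auto
    also have "\<dots> \<le> 2 * Q B x" using half B(1) by blast
    finally show ?thesis by simp
  qed
  moreover have "Q B x \<le> T' / 2 * (3/2 + 45 * sqrt (r / (T' / 2))) * n2 x" for x
  proof -
    have "2 * Q B x \<le> (1 + 9 * s) * Q S x" using half B(1) by blast
    also have "\<dots> \<le> (1 + 9 * s) * (T' * (3/2 + 45 * s) * n2 x)" using hi s0 by (intro mult_left_mono) auto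
    also have "\<dots> = T' * ((1 + 9 * s) * (3/2 + 45 * s)) * n2 x" by simp
    also have "\<dots> \<le> T' * (3/2 + 45 * sqrt (r / (T' / 2))) * n2 x"
      using bounds(2) T' n2 by (intro mult_right_mono mult_left_mono) auto
    finally show ?thesis by simp
  qed
  moreover have "B \<subseteq> J" using A(1) B(1) S(1) by blast
  ultimately show ?case
    unfolding T2 n2_def[symmetric] Q_def[symmetric] by blast
qed

text \<open>Halving stops just before the nominal size would fall below 32400 * r. The accumulated
  error is still at most 1/4 there, leaving 1/2 - 1/4 below and 3/2 + 1/4 <= 2 above.\<close>

lemma exists_subset_form_bounds:
  fixes v :: "'j \<Rightarrow> nat \<Rightarrow> complex" and r T :: real
  assumes fin: "finite J" and r: "0 < r"
    and bd: "\<And>j. j \<in> J \<Longrightarrow> (\<Sum>a<d. (cmod (v j a))\<^sup>2) \<le> r"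
    and card: "real (card J) \<le> T" and T: "32400 * r \<le> T"
    and low: "\<And>x. 1/2 * T * (\<Sum>a<d. (cmod (x a))\<^sup>2) \<le> (\<Sum>i\<in>J. (cmod (pairing d (v i) x))\<^sup>2)"
    and up: "\<And>x. (\<Sum>i\<in>J. (cmod (pairing d (v i) x))\<^sup>2) \<le> 3/2 * T * (\<Sum>a<d. (cmod (x a))\<^sup>2)"
  obtains S T' where "S \<subseteq> J" "0 < T'" "T' \<le> 64800 * r" "real (card S) \<le> T'"
    "\<And>x. 1/4 * T' * (\<Sum>a<d. (cmod (x a))\<^sup>2) \<le> (\<Sum>i\<in>S. (cmod (pairing d (v i) x))\<^sup>2)"
    "\<And>x. (\<Sum>i\<in>S. (cmod (pairing d (v i) x))\<^sup>2) \<le> 2 * T' * (\<Sum>a<d. (cmod (x a))\<^sup>2)"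
proof -
  obtain n where "T / (32400 * r) < 2 ^ n" using real_arch_pow[of 2] by auto
  then have ex: "T / 2 ^ n < 32400 * r" using r by (simp add: field_simps)
  define l where "l = (LEAST n. T / 2 ^ n < 32400 * r)"
  have l: "T / 2 ^ l < 32400 * r" unfolding l_def by (rule LeastI, rule ex)
  have "l \<noteq> 0" using l T by (intro notI) simp
  then obtain k where k: "l = Suc k" by (cases l) auto
  have "\<not> T / 2 ^ k < 32400 * r" using not_less_Least[of k "\<lambda>n. T / 2 ^ n < 32400 * r"] k by (simp add: l_def)
  define T' where "T' = T / 2 ^ k"
  have T': "32400 * r \<le> T'" "T' \<le> 64800 * r" "0 < T'"
    using \<open>\<not> T / 2 ^ k < 32400 * r\<close> l r by (auto simp: k T'_def)
  obtain S where S: "S \<subseteq> J" "real (card S) \<le> T'"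
    "\<And>x. T' * (1/2 - 45 * sqrt (r / T')) * (\<Sum>a<d. (cmod (x a))\<^sup>2) \<le> (\<Sum>i\<in>S. (cmod (pairing d (v i) x))\<^sup>2)"
    "\<And>x. (\<Sum>i\<in>S. (cmod (pairing d (v i) x))\<^sup>2) \<le> T' * (3/2 + 45 * sqrt (r / T')) * (\<Sum>a<d. (cmod (x a))\<^sup>2)"
    using iterated_halving[OF fin r bd card low up, of k] T'(1) unfolding T'_def[symmetric] by blast
  note b = halving_sqrt_bounds(3)[OF r T'(1)]
  show ?thesis
  proof (rule that[OF S(1) T'(3) T'(2) S(2)])
    fix x :: "nat \<Rightarrow> complex"
    have n2: "0 \<le> (\<Sum>a<d. (cmod (x a))\<^sup>2)" by (simp add: sum_nonneg)
    have "T' * (1/4) * (\<Sum>a<d. (cmod (x a))\<^sup>2) \<le> T' * (1/2 - 45 * sqrt (r / T')) * (\<Sum>a<d. (cmod (x a))\<^sup>2)"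
      using b T' n2 by (intro mult_right_mono mult_left_mono) auto
    also note S(3)
    finally show "1/4 * T' * (\<Sum>a<d. (cmod (x a))\<^sup>2) \<le> (\<Sum>i\<in>S. (cmod (pairing d (v i) x))\<^sup>2)" by simp
    have "T' * (3/2 + 45 * sqrt (r / T')) * (\<Sum>a<d. (cmod (x a))\<^sup>2) \<le> T' * 2 * (\<Sum>a<d. (cmod (x a))\<^sup>2)"
      using b T' n2 by (intro mult_right_mono mult_left_mono) auto
    then show "(\<Sum>i\<in>S. (cmod (pairing d (v i) x))\<^sup>2) \<le> 2 * T' * (\<Sum>a<d. (cmod (x a))\<^sup>2)"
      using S(4)[of x] by simp
  qed
qed

subsection \<open>Sampling\<close>

text \<open>Each new point is chosen so that the cross term with the sum so far is nonpositive.\<close>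

lemma (in prob_space) exists_points_small_sums:
  fixes f :: "'p \<Rightarrow> 'a \<Rightarrow> complex"
  assumes fin: "finite P"
    and int: "\<And>p. p \<in> P \<Longrightarrow> integrable M (f p)"
    and zero: "\<And>p. p \<in> P \<Longrightarrow> (\<integral>x. f p x \<partial>M) = 0"
    and bd: "\<And>p x. p \<in> P \<Longrightarrow> x \<in> space M \<Longrightarrow> cmod (f p x) \<le> C"
  shows "\<exists>\<xi>. (\<forall>j<k. \<xi> j \<in> space M) \<and>
    (\<Sum>p\<in>P. (cmod (\<Sum>j<k. f p (\<xi> j)))\<^sup>2) \<le> real k * (real (card P) * C\<^sup>2)"
proof (induction k)
  case (Suc k)
  then obtain \<xi> where \<xi>: "\<forall>j<k. \<xi> j \<in> space M"
    "(\<Sum>p\<in>P. (cmod (\<Sum>j<k. f p (\<xi> j)))\<^sup>2) \<le> real k * (real (card P) * C\<^sup>2)" by blast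
  define E where "E p = (\<Sum>j<k. f p (\<xi> j))" for p
  define g where "g x = Re (\<Sum>p\<in>P. cnj (E p) * f p x)" for x
  have ig: "integrable M (\<lambda>x. \<Sum>p\<in>P. cnj (E p) * f p x)"
    using int by (intro Bochner_Integration.integrable_sum integrable_mult_right) auto
  have "(\<integral>x. g x \<partial>M) = Re (\<integral>x. (\<Sum>p\<in>P. cnj (E p) * f p x) \<partial>M)"
    unfolding g_def by (rule integral_Re[OF ig])
  also have "(\<integral>x. (\<Sum>p\<in>P. cnj (E p) * f p x) \<partial>M) = (\<Sum>p\<in>P. cnj (E p) * (\<integral>x. f p x \<partial>M))"
    using int by (subst Bochner_Integration.integral_sum) auto
  finally have g0: "(\<integral>x. g x \<partial>M) = 0" using zero by simp
  \<comment> \<open>A function with mean zero cannot be positive everywhere.\<close>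
  have "\<exists>x\<in>space M. g x \<le> 0"
  proof (rule ccontr)
    assume "\<not> ?thesis"
    then have "0 < g x" if "x \<in> space M" for x using that by force
    then have "(\<integral>x. 0 \<partial>M) < (\<integral>x. g x \<partial>M)"
      using integrable_Re[OF ig] unfolding g_def
      by (intro integral_less_AE_space) (auto simp: emeasure_space_1)
    with g0 show False by simp
  qed
  then obtain x where x: "x \<in> space M" "g x \<le> 0" by blast
  define \<xi>' where "\<xi>' = \<xi>(k := x)"
  have e: "(\<Sum>j<Suc k. f p (\<xi>' j)) = E p + f p x" for p
    by (simp add: \<xi>'_def E_def)
  have sq: "(cmod (E p + f p x))\<^sup>2 = (cmod (E p))\<^sup>2 + 2 * Re (cnj (E p) * f p x) + (cmod (f p x))\<^sup>2" for p
    unfolding cmod_power2 by (simp add: power2_eq_square algebra_simps)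
  have "(\<Sum>p\<in>P. (cmod (\<Sum>j<Suc k. f p (\<xi>' j)))\<^sup>2)
      = (\<Sum>p\<in>P. (cmod (E p))\<^sup>2) + 2 * g x + (\<Sum>p\<in>P. (cmod (f p x))\<^sup>2)"
    unfolding e sq by (simp add: sum.distrib g_def sum_distrib_left)
  also have "\<dots> \<le> real k * (real (card P) * C\<^sup>2) + 2 * 0 + (\<Sum>p\<in>P. C\<^sup>2)"
    using \<xi>(2) x bd unfolding E_def by (intro add_mono mult_left_mono sum_mono power_mono) auto
  also have "\<dots> = real (Suc k) * (real (card P) * C\<^sup>2)" by (simp add: algebra_simps)
  finally show ?case using \<xi>(1) x(1) by (intro exI[of _ \<xi>']) (auto simp: \<xi>'_def less_Suc_eq)
qed simp

lemma integrable_mult_cnj: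
  fixes f g :: "'x \<Rightarrow> complex"
  assumes f: "square_integrable M f" and g: "square_integrable M g"
  shows "integrable M (\<lambda>x. f x * cnj (g x))"
proof (rule Bochner_Integration.integrable_bound)
  show "integrable M (\<lambda>x. (norm (f x))\<^sup>2 + (norm (g x))\<^sup>2)"
    using f g by (auto simp: square_integrable_def)
  have [measurable]: "f \<in> borel_measurable M" "g \<in> borel_measurable M"
    using f g by (auto simp: square_integrable_def)
  have "(\<lambda>x. cnj (g x)) \<in> borel_measurable M"
    using borel_measurable_continuous_onI[of cnj] by (rule measurable_compose[rotated]) (auto intro: continuous_intros)
  then show "(\<lambda>x. f x * cnj (g x)) \<in> borel_measurable M" by measurable
  have "norm (f x * cnj (g x)) \<le> norm ((norm (f x))\<^sup>2 + (norm (g x))\<^sup>2)" for x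
  proof -
    have "norm (f x * cnj (g x)) = norm (f x) * norm (g x)" by (simp add: norm_mult)
    also have "\<dots> \<le> (norm (f x))\<^sup>2 + (norm (g x))\<^sup>2"
      using sum_squares_bound[of "norm (f x)" "norm (g x)"]
        mult_nonneg_nonneg[OF norm_ge_zero[of "f x"] norm_ge_zero[of "g x"]] by linarith
    finally show ?thesis by simp
  qed
  then show "AE x in M. norm (f x * cnj (g x)) \<le> norm ((norm (f x))\<^sup>2 + (norm (g x))\<^sup>2)" by simp
qed

lemma norm_L2_squared: "(norm_L2 M f)\<^sup>2 = (\<integral>x. (norm (f x))\<^sup>2 \<partial>M)"
  by (simp add: norm_L2_def)

lemma norm_L2_lin_comb:
  fixes u :: "nat \<Rightarrow> 'x \<Rightarrow> complex"
  assumes "orthonormal_complex M N u"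
  shows "(norm_L2 M (lin_comb N u c))\<^sup>2 = (\<Sum>i=1..N. (cmod (c i))\<^sup>2)"
proof -
  have int: "integrable M (\<lambda>x. u i x * cnj (u j x))" if "i \<in> {1..N}" "j \<in> {1..N}" for i j
    using assms that unfolding orthonormal_complex_def by (intro integrable_mult_cnj) auto
  have "complex_of_real ((norm (lin_comb N u c x))\<^sup>2)
      = (\<Sum>i=1..N. \<Sum>j=1..N. c i * cnj (c j) * (u i x * cnj (u j x)))" for x
    unfolding complex_norm_square lin_comb_def cnj_sum sum_product complex_cnj_mult
    by (intro sum.cong refl) (simp add: mult_ac)
  then have "complex_of_real (\<integral>x. (norm (lin_comb N u c x))\<^sup>2 \<partial>M)
      = (\<integral>x. (\<Sum>i=1..N. \<Sum>j=1..N. c i * cnj (c j) * (u i x * cnj (u j x))) \<partial>M)"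
    by (simp flip: integral_complex_of_real)
  also have "\<dots> = (\<Sum>i=1..N. \<integral>x. (\<Sum>j=1..N. c i * cnj (c j) * (u i x * cnj (u j x))) \<partial>M)"
    by (intro Bochner_Integration.integral_sum Bochner_Integration.integrable_sum integrable_mult_right int)
  also have "\<dots> = (\<Sum>i=1..N. \<Sum>j=1..N. c i * cnj (c j) * (\<integral>x. u i x * cnj (u j x) \<partial>M))"
  proof (intro sum.cong refl)
    fix i assume "i \<in> {1..N}"
    then have "(\<integral>x. (\<Sum>j=1..N. c i * cnj (c j) * (u i x * cnj (u j x))) \<partial>M)
        = (\<Sum>j=1..N. \<integral>x. c i * cnj (c j) * (u i x * cnj (u j x)) \<partial>M)"
      by (intro Bochner_Integration.integral_sum integrable_mult_right int)
    then show "(\<integral>x. (\<Sum>j=1..N. c i * cnj (c j) * (u i x * cnj (u j x))) \<partial>M)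
        = (\<Sum>j=1..N. c i * cnj (c j) * (\<integral>x. u i x * cnj (u j x) \<partial>M))" by simp
  qed
  also have "\<dots> = (\<Sum>i=1..N. \<Sum>j=1..N. if i = j then c i * cnj (c j) else 0)"
    using assms unfolding orthonormal_complex_def by (intro sum.cong refl) auto
  also have "\<dots> = (\<Sum>i=1..N. c i * cnj (c i))"
    by (intro sum.cong refl) (simp add: sum.delta')
  also have "\<dots> = complex_of_real (\<Sum>i=1..N. (cmod (c i))\<^sup>2)"
    unfolding of_real_sum complex_norm_square ..
  finally show ?thesis unfolding norm_L2_squared by (simp only: of_real_eq_iff)
qed

lemma lin_comb_eq_pairing: "lin_comb N u c x = pairing N (\<lambda>a. u (Suc a) x) (\<lambda>a. c (Suc a))"
  unfolding lin_comb_def pairing_def One_nat_def sum.atLeast1_atMost_eq by (simp add: mult.commute)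

text \<open>The greedy choice is applied to the entries of the centered Gram matrix, which have mean
  zero and modulus at most r + 1. The size of \<open>K\<close> makes every entry of the summed error
  at most K / (2 * N), so the error form is at most K / 2 times the squared length.\<close>

lemma (in prob_space) exists_points_form_bounds:
  fixes w :: "'a \<Rightarrow> nat \<Rightarrow> complex"
  assumes r: "0 < r" and N: "1 \<le> N"
    and bd: "\<And>x. x \<in> space M \<Longrightarrow> (\<Sum>a<N. (cmod (w x a))\<^sup>2) \<le> r"
    and int: "\<And>a b. a < N \<Longrightarrow> b < N \<Longrightarrow> integrable M (\<lambda>x. w x a * cnj (w x b))"
    and on: "\<And>a b. a < N \<Longrightarrow> b < N \<Longrightarrow> (\<integral>x. w x a * cnj (w x b) \<partial>M) = (if a = b then 1 else 0)"
    and K: "4 * real N ^ 4 * (r + 1)\<^sup>2 \<le> real K"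
  obtains \<xi> where "\<And>j. j < K \<Longrightarrow> \<xi> j \<in> space M"
    "\<And>x. 1/2 * real K * (\<Sum>a<N. (cmod (x a))\<^sup>2) \<le> (\<Sum>j<K. (cmod (pairing N (w (\<xi> j)) x))\<^sup>2)"
    "\<And>x. (\<Sum>j<K. (cmod (pairing N (w (\<xi> j)) x))\<^sup>2) \<le> 3/2 * real K * (\<Sum>a<N. (cmod (x a))\<^sup>2)"
proof -
  define f where "f p x = w x (fst p) * cnj (w x (snd p)) - (if fst p = snd p then 1 else 0)" for p x
  let ?P = "{..<N} \<times> {..<N}"
  have intf: "integrable M (f p)" if "p \<in> ?P" for p
    unfolding f_def using that by (intro Bochner_Integration.integrable_diff int) auto
  have zerof: "(\<integral>x. f p x \<partial>M) = 0" if "p \<in> ?P" for p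
    unfolding f_def using that by (subst Bochner_Integration.integral_diff) (auto intro!: int simp: on prob_space)
  have wr: "(cmod (w x a))\<^sup>2 \<le> r" if "x \<in> space M" "a < N" for x a
    using member_le_sum[of a "{..<N}" "\<lambda>a. (cmod (w x a))\<^sup>2"] bd[OF that(1)] that(2) by simp
  have bdf: "cmod (f p x) \<le> r + 1" if "p \<in> ?P" "x \<in> space M" for p x
  proof -
    have "cmod (f p x) \<le> cmod (w x (fst p) * cnj (w x (snd p))) + cmod (if fst p = snd p then 1 else 0)"
      unfolding f_def by (rule norm_triangle_ineq4)
    also have "\<dots> \<le> cmod (w x (fst p)) * cmod (w x (snd p)) + 1" by (simp add: norm_mult)
    finally have "cmod (f p x) \<le> cmod (w x (fst p)) * cmod (w x (snd p)) + 1" .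
    moreover have "2 * cmod (w x (fst p)) * cmod (w x (snd p)) \<le> r + r"
      using wr[of x "fst p"] wr[of x "snd p"] that sum_squares_bound[of "cmod (w x (fst p))" "cmod (w x (snd p))"]
      by auto
    ultimately show ?thesis by linarith
  qed
  obtain \<xi> where \<xi>: "\<forall>j<K. \<xi> j \<in> space M"
    "(\<Sum>p\<in>?P. (cmod (\<Sum>j<K. f p (\<xi> j)))\<^sup>2) \<le> real K * (real (card ?P) * (r + 1)\<^sup>2)"
    using exists_points_small_sums[of ?P f "r + 1" K] intf zerof bdf by auto
  define E where "E a b = (\<Sum>j<K. f (a, b) (\<xi> j))" for a b
  have N0: "0 < real N" using N by simp
  have E: "cmod (E a b) \<le> real K / (2 * real N)" if "a < N" "b < N" for a b
  proof (rule power2_le_imp_le)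
    have "(cmod (E a b))\<^sup>2 \<le> (\<Sum>p\<in>?P. (cmod (\<Sum>j<K. f p (\<xi> j)))\<^sup>2)"
      unfolding E_def using that
      by (intro member_le_sum[of "(a, b)" ?P "\<lambda>p. (cmod (\<Sum>j<K. f p (\<xi> j)))\<^sup>2"]) auto
    also have "\<dots> \<le> real K * (real N ^ 2 * (r + 1)\<^sup>2)" using \<xi>(2) by (simp add: power2_eq_square)
    also have "real N ^ 2 * (r + 1)\<^sup>2 = 4 * real N ^ 4 * (r + 1)\<^sup>2 / (4 * real N ^ 2)"
      using N0 by (simp add: power2_eq_square power4_eq_xxxx)
    also have "\<dots> \<le> real K / (4 * real N ^ 2)" using K N0 by (intro divide_right_mono) auto
    also have "real K * (real K / (4 * real N ^ 2)) = (real K / (2 * real N))\<^sup>2"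
      by (simp add: power2_eq_square)
    finally show "(cmod (E a b))\<^sup>2 \<le> (real K / (2 * real N))\<^sup>2" by (simp add: mult_left_mono)
  qed (use N0 in simp)
  have close: "\<bar>(\<Sum>j<K. (cmod (pairing N (w (\<xi> j)) x))\<^sup>2) - real K * (\<Sum>a<N. (cmod (x a))\<^sup>2)\<bar>
    \<le> 1/2 * real K * (\<Sum>a<N. (cmod (x a))\<^sup>2)" for x
  proof -
    define n2 where "n2 = (\<Sum>a<N. (cmod (x a))\<^sup>2)"
    have diag: "(\<Sum>a<N. \<Sum>b<N. (if a = b then 1 else 0) * (x a * cnj (x b))) = complex_of_real n2"
    proof -
      have "(\<Sum>b<N. (if a = b then 1 else 0) * (x a * cnj (x b))) = x a * cnj (x a)" if "a < N" for a
      proof -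
        have "(\<Sum>b<N. (if a = b then 1 else 0) * (x a * cnj (x b))) = (\<Sum>b<N. if a = b then x a * cnj (x b) else 0)"
          by (intro sum.cong) auto
        then show ?thesis using that by simp
      qed
      then show ?thesis unfolding n2_def of_real_sum complex_norm_square by (intro sum.cong) auto
    qed
    have "complex_of_real ((cmod (pairing N (w y) x))\<^sup>2) = (\<Sum>a<N. \<Sum>b<N. f (a, b) y * (x a * cnj (x b))) + of_real n2" for y
    proof -
      have "complex_of_real ((cmod (pairing N (w y) x))\<^sup>2) = (\<Sum>a<N. \<Sum>b<N. (w y a * cnj (w y b)) * (x a * cnj (x b)))"
        unfolding complex_norm_square pairing_def cnj_sum sum_product complex_cnj_mult
        by (intro sum.cong refl) (simp add: mult_ac)
      also have "\<dots> = (\<Sum>a<N. \<Sum>b<N. f (a, b) y * (x a * cnj (x b)) + (if a = b then 1 else 0) * (x a * cnj (x b)))"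
        by (intro sum.cong refl) (simp add: f_def algebra_simps)
      finally show ?thesis by (simp only: sum.distrib diag)
    qed
    then have "complex_of_real (\<Sum>j<K. (cmod (pairing N (w (\<xi> j)) x))\<^sup>2)
        = (\<Sum>j<K. \<Sum>a<N. \<Sum>b<N. f (a, b) (\<xi> j) * (x a * cnj (x b))) + of_real (real K * n2)"
      unfolding of_real_sum by (simp add: sum.distrib)
    also have "(\<Sum>j<K. \<Sum>a<N. \<Sum>b<N. f (a, b) (\<xi> j) * (x a * cnj (x b)))
        = (\<Sum>a<N. \<Sum>j<K. \<Sum>b<N. f (a, b) (\<xi> j) * (x a * cnj (x b)))" by (rule sum.swap)
    also have "\<dots> = (\<Sum>a<N. \<Sum>b<N. \<Sum>j<K. f (a, b) (\<xi> j) * (x a * cnj (x b)))"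
      by (intro sum.cong refl sum.swap)
    also have "\<dots> = (\<Sum>a<N. \<Sum>b<N. E a b * (x a * cnj (x b)))"
      unfolding E_def sum_distrib_right ..
    finally have "complex_of_real ((\<Sum>j<K. (cmod (pairing N (w (\<xi> j)) x))\<^sup>2) - real K * n2)
        = (\<Sum>a<N. \<Sum>b<N. E a b * (x a * cnj (x b)))" by simp
    then have "cmod (complex_of_real ((\<Sum>j<K. (cmod (pairing N (w (\<xi> j)) x))\<^sup>2) - real K * n2))
        = cmod (\<Sum>a<N. \<Sum>b<N. E a b * (x a * cnj (x b)))" by (rule arg_cong)
    then have "\<bar>(\<Sum>j<K. (cmod (pairing N (w (\<xi> j)) x))\<^sup>2) - real K * n2\<bar>
        = cmod (\<Sum>a<N. \<Sum>b<N. E a b * (x a * cnj (x b)))" by (simp only: norm_of_real)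
    also have "\<dots> \<le> (\<Sum>a<N. \<Sum>b<N. cmod (E a b * (x a * cnj (x b))))"
      by (rule order_trans[OF norm_sum]) (intro sum_mono norm_sum)
    also have "\<dots> \<le> (\<Sum>a<N. \<Sum>b<N. real K / (2 * real N) * (cmod (x a) * cmod (x b)))"
      unfolding norm_mult complex_mod_cnj by (intro sum_mono mult_right_mono E) auto
    also have "\<dots> = real K / (2 * real N) * (\<Sum>a<N. cmod (x a))\<^sup>2"
      unfolding power2_eq_square sum_product unfolding sum_distrib_left ..
    also have "\<dots> \<le> real K / (2 * real N) * (real N * n2)"
      using Cauchy_Schwarz_ineq_sum[of "\<lambda>_. 1" "\<lambda>a. cmod (x a)" "{..<N}"] N0
      unfolding n2_def by (intro mult_left_mono) auto
    also have "\<dots> = 1/2 * real K * n2" using N0 by simp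
    finally show ?thesis unfolding n2_def .
  qed
  show ?thesis
  proof (rule that)
    show "\<xi> j \<in> space M" if "j < K" for j using \<xi>(1) that by blast
    show "1/2 * real K * (\<Sum>a<N. (cmod (x a))\<^sup>2) \<le> (\<Sum>j<K. (cmod (pairing N (w (\<xi> j)) x))\<^sup>2)" for x
      using close[of x] by linarith
    show "(\<Sum>j<K. (cmod (pairing N (w (\<xi> j)) x))\<^sup>2) \<le> 3/2 * real K * (\<Sum>a<N. (cmod (x a))\<^sup>2)" for x
      using close[of x] by linarith
  qed
qed

text \<open>By orthonormality the L2 norm is the length of the coefficient vector, so the selected
  forms bound the discrete sums. What remains is to replace the nominal size by the number of
  selected points.\<close>

lemma (in prob_space) discretization_complex:
  fixes u :: "nat \<Rightarrow> 'a \<Rightarrow> complex"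
  assumes N: "1 \<le> N" and t: "0 < t" and on: "orthonormal_complex M N u"
    and bd: "\<And>x. x \<in> space M \<Longrightarrow> (\<Sum>i=1..N. (cmod (u i x))\<^sup>2) \<le> real N * t\<^sup>2"
  shows "\<exists>m \<xi>. 1 \<le> m \<and> real m \<le> 64800 * t\<^sup>2 * real N \<and> (\<forall>j\<in>{1..m}. \<xi> j \<in> space M) \<and>
    discretizes_L2 (1/4) (8 * t\<^sup>2) M N u m \<xi>"
proof -
  define r where "r = real N * t\<^sup>2"
  have r: "0 < r" using N t by (simp add: r_def)
  define w where "w x a = u (Suc a) x" for x a
  have wbd: "(\<Sum>a<N. (cmod (w x a))\<^sup>2) \<le> r" if "x \<in> space M" for x
    using bd[OF that] unfolding One_nat_def sum.atLeast1_atMost_eq w_def r_def .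
  have wint: "integrable M (\<lambda>x. w x a * cnj (w x b))" if "a < N" "b < N" for a b
    unfolding w_def using on that unfolding orthonormal_complex_def by (intro integrable_mult_cnj) auto
  have won: "(\<integral>x. w x a * cnj (w x b) \<partial>M) = (if a = b then 1 else 0)" if "a < N" "b < N" for a b
    unfolding w_def using on that unfolding orthonormal_complex_def by auto
  obtain K :: nat where K: "max (4 * real N ^ 4 * (r + 1)\<^sup>2) (32400 * r) \<le> real K"
    using real_arch_simple by blast
  then have K1: "4 * real N ^ 4 * (r + 1)\<^sup>2 \<le> real K" and K2: "32400 * r \<le> real K" by simp_all
  obtain \<xi> where \<xi>: "\<And>j. j < K \<Longrightarrow> \<xi> j \<in> space M"
    "\<And>x. 1/2 * real K * (\<Sum>a<N. (cmod (x a))\<^sup>2) \<le> (\<Sum>j<K. (cmod (pairing N (w (\<xi> j)) x))\<^sup>2)"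
    "\<And>x. (\<Sum>j<K. (cmod (pairing N (w (\<xi> j)) x))\<^sup>2) \<le> 3/2 * real K * (\<Sum>a<N. (cmod (x a))\<^sup>2)"
    using exists_points_form_bounds[OF r N wbd wint won K1] by blast
  have vbd: "(\<Sum>a<N. (cmod (w (\<xi> j) a))\<^sup>2) \<le> r" if "j \<in> {..<K}" for j
    using that by (intro wbd \<xi>(1)) simp
  obtain S T where S: "S \<subseteq> {..<K}" "0 < T" "T \<le> 64800 * r" "real (card S) \<le> T"
    and lo: "\<And>x. 1/4 * T * (\<Sum>a<N. (cmod (x a))\<^sup>2) \<le> (\<Sum>i\<in>S. (cmod (pairing N (w (\<xi> i)) x))\<^sup>2)"
    and hi: "\<And>x. (\<Sum>i\<in>S. (cmod (pairing N (w (\<xi> i)) x))\<^sup>2) \<le> 2 * T * (\<Sum>a<N. (cmod (x a))\<^sup>2)"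
    using exists_subset_form_bounds[where J = "{..<K}" and r = r and d = N and v = "\<lambda>j. w (\<xi> j)" and T = "real K",
        OF _ r vbd _ K2 \<xi>(2,3)] by auto
  have finS: "finite S" using S(1) finite_subset by blast
  \<comment> \<open>A trace comparison: the lower form bound is summed over the unit vectors and set
    against the bound \<open>r\<close> on the squared length of each selected vector. It also shows
    that the selection is nonempty.\<close>
  have "real N * (1/4 * T) \<le> real (card S) * r"
  proof -
    define e where "e b a = (if a = b then 1 else 0 :: complex)" for a b :: nat
    have ipe: "pairing N v (e b) = v b" if "b < N" for v b
    proof -
      have "pairing N v (e b) = (\<Sum>a<N. if a = b then v a else 0)"
        unfolding pairing_def e_def by (intro sum.cong) auto
      then show ?thesis using that by simp
    qed
    have n2e: "(\<Sum>a<N. (cmod (e b a))\<^sup>2) = 1" if "b < N" for b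
    proof -
      have "(\<Sum>a<N. (cmod (e b a))\<^sup>2) = (\<Sum>a<N. if a = b then 1 else 0)"
        unfolding e_def by (intro sum.cong) auto
      then show ?thesis using that by simp
    qed
    have "real N * (1/4 * T) = (\<Sum>b<N. 1/4 * T)" by simp
    also have "\<dots> \<le> (\<Sum>b<N. \<Sum>i\<in>S. (cmod (w (\<xi> i) b))\<^sup>2)"
    proof (rule sum_mono)
      fix b assume "b \<in> {..<N}"
      then show "1/4 * T \<le> (\<Sum>i\<in>S. (cmod (w (\<xi> i) b))\<^sup>2)"
        using lo[of "e b"] by (simp add: ipe n2e)
    qed
    also have "\<dots> = (\<Sum>i\<in>S. \<Sum>b<N. (cmod (w (\<xi> i) b))\<^sup>2)" by (rule sum.swap)
    also have "\<dots> \<le> (\<Sum>i\<in>S. r)" using vbd S(1) by (intro sum_mono) auto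
    finally show ?thesis by simp
  qed
  then have Tm: "T \<le> 4 * t\<^sup>2 * real (card S)" using N by (simp add: r_def field_simps)
  then have m: "1 \<le> card S" using S(2) by (cases "card S") auto
  obtain h where h: "bij_betw h {1..card S} S" using ex_bij_betw_nat_finite_1[OF finS] by blast
  show ?thesis
  proof (intro exI[of _ "card S"] exI[of _ "\<xi> \<circ> h"] conjI m ballI)
    show "real (card S) \<le> 64800 * t\<^sup>2 * real N" using S(3,4) by (simp add: r_def mult_ac)
    show "(\<xi> \<circ> h) j \<in> space M" if "j \<in> {1..card S}" for j
    proof -
      have "h j < K" using bij_betwE[OF h] that S(1) by blast
      then show ?thesis using \<xi>(1) by simp
    qed
    show "discretizes_L2 (1/4) (8 * t\<^sup>2) M N u (card S) (\<xi> \<circ> h)"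
      unfolding discretizes_L2_def
    proof (intro allI)
      fix c :: "nat \<Rightarrow> complex"
      define n2 where "n2 = (\<Sum>a<N. (cmod (c (Suc a)))\<^sup>2)"
      define Q where "Q = (\<Sum>i\<in>S. (cmod (pairing N (w (\<xi> i)) (\<lambda>a. c (Suc a))))\<^sup>2)"
      have n2: "(norm_L2 M (lin_comb N u c))\<^sup>2 = n2"
        unfolding norm_L2_lin_comb[OF on] n2_def One_nat_def sum.atLeast1_atMost_eq ..
      have Q: "(\<Sum>j=1..card S. (norm (lin_comb N u c ((\<xi> \<circ> h) j)))\<^sup>2) = Q"
        unfolding lin_comb_eq_pairing Q_def w_def comp_def
        by (rule sum.reindex_bij_betw[OF h])
      have n0: "0 \<le> n2" by (simp add: n2_def sum_nonneg)
      have m0: "0 < real (card S)" using m by simp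
      have "real (card S) * (1/4 * n2) \<le> T * (1/4 * n2)" using S(4) n0 by (intro mult_right_mono) auto
      also have "\<dots> \<le> Q" using lo[of "\<lambda>a. c (Suc a)"] by (simp add: n2_def Q_def mult_ac)
      finally have 1: "1/4 * n2 \<le> 1 / real (card S) * Q" using m0 by (simp add: field_simps)
      have "Q \<le> T * (2 * n2)" using hi[of "\<lambda>a. c (Suc a)"] by (simp add: n2_def Q_def mult_ac)
      also have "\<dots> \<le> 4 * t\<^sup>2 * real (card S) * (2 * n2)" using Tm n0 by (intro mult_right_mono) auto
      finally have 2: "1 / real (card S) * Q \<le> 8 * t\<^sup>2 * n2" using m0 by (simp add: field_simps)
      show "1/4 * (norm_L2 M (lin_comb N u c))\<^sup>2 \<le> 1 / real (card S) * (\<Sum>j=1..card S. (norm (lin_comb N u c ((\<xi> \<circ> h) j)))\<^sup>2) \<and>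
        1 / real (card S) * (\<Sum>j=1..card S. (norm (lin_comb N u c ((\<xi> \<circ> h) j)))\<^sup>2) \<le> 8 * t\<^sup>2 * (norm_L2 M (lin_comb N u c))\<^sup>2"
        unfolding n2 Q using 1 2 by blast
    qed
  qed
qed

section \<open>The real case and the final statement\<close>

lemma orthonormal_complex_of_real:
  assumes "orthonormal_real M N u"
  shows "orthonormal_complex M N (\<lambda>i x. complex_of_real (u i x))"
  using assms unfolding orthonormal_real_def orthonormal_complex_def square_integrable_def
  by (auto simp flip: of_real_mult)

lemma lin_comb_of_real:
  "lin_comb N (\<lambda>i x. complex_of_real (u i x)) (\<lambda>i. complex_of_real (c i)) x = of_real (lin_comb N u c x)"
  by (simp add: lin_comb_def)

text \<open>Real coefficients are among the complex ones, and the embedding preserves all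
  moduli.\<close>

lemma discretizes_L2_of_complex:
  assumes "discretizes_L2 A B M N (\<lambda>i x. complex_of_real (u i x)) m \<xi>"
  shows "discretizes_L2 A B M N u m \<xi>"
  unfolding discretizes_L2_def
proof
  fix c :: "nat \<Rightarrow> real"
  have "norm_L2 M (lin_comb N (\<lambda>i x. complex_of_real (u i x)) (\<lambda>i. complex_of_real (c i))) = norm_L2 M (lin_comb N u c)"
    unfolding norm_L2_def lin_comb_of_real by simp
  with assms[unfolded discretizes_L2_def, rule_format, of "\<lambda>i. complex_of_real (c i)"]
  show "A * (norm_L2 M (lin_comb N u c))\<^sup>2 \<le> 1 / real m * (\<Sum>j=1..m. (norm (lin_comb N u c (\<xi> j)))\<^sup>2) \<and>
    1 / real m * (\<Sum>j=1..m. (norm (lin_comb N u c (\<xi> j)))\<^sup>2) \<le> B * (norm_L2 M (lin_comb N u c))\<^sup>2"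
    unfolding lin_comb_of_real by simp
qed

theorem theorem1p1:
  shows "\<exists>C1 C2 C3 :: real. 0 < C1 \<and> 0 < C2 \<and> 0 < C3 \<and>
    (\<forall>(d::nat) (\<Omega> :: (nat \<Rightarrow> real) set) (\<mu> :: (nat \<Rightarrow> real) measure) (N::nat) (t::real).
      \<Omega> \<subseteq> euclidean_points d \<longrightarrow> \<Omega> \<noteq> {} \<longrightarrow> prob_space \<mu> \<longrightarrow> space \<mu> = \<Omega> \<longrightarrow>
      1 \<le> N \<longrightarrow> 0 < t \<longrightarrow>
      (\<forall>u :: nat \<Rightarrow> (nat \<Rightarrow> real) \<Rightarrow> real.
        orthonormal_real \<mu> N u \<longrightarrow>
        (\<forall>x\<in>\<Omega>. (\<Sum>i=1..N. \<bar>u i x\<bar>\<^sup>2) \<le> real N * t\<^sup>2) \<longrightarrow>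
        (\<exists>m \<xi>. 1 \<le> m \<and> real m \<le> C1 * t\<^sup>2 * real N \<and> (\<forall>j\<in>{1..m}. \<xi> j \<in> \<Omega>) \<and>
           discretizes_L2 C2 (C3 * t\<^sup>2) \<mu> N u m \<xi>)) \<and>
      (\<forall>u :: nat \<Rightarrow> (nat \<Rightarrow> real) \<Rightarrow> complex.
        orthonormal_complex \<mu> N u \<longrightarrow>
        (\<forall>x\<in>\<Omega>. (\<Sum>i=1..N. (cmod (u i x))\<^sup>2) \<le> real N * t\<^sup>2) \<longrightarrow>
        (\<exists>m \<xi>. 1 \<le> m \<and> real m \<le> C1 * t\<^sup>2 * real N \<and> (\<forall>j\<in>{1..m}. \<xi> j \<in> \<Omega>) \<and>
           discretizes_L2 C2 (C3 * t\<^sup>2) \<mu> N u m \<xi>)))"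
proof (rule exI[of _ 64800], rule exI[of _ "1/4"], rule exI[of _ 8], intro conjI allI impI, goal_cases)
  \<comment> \<open>Goals 1 to 3 are the positivity of the constants; goal 4 is the real case and
    goal 5 the complex one.\<close>
  case (4 d \<Omega> \<mu> N t u)
  then have "\<exists>m \<xi>. 1 \<le> m \<and> real m \<le> 64800 * t\<^sup>2 * real N \<and> (\<forall>j\<in>{1..m}. \<xi> j \<in> space \<mu>) \<and>
      discretizes_L2 (1/4) (8 * t\<^sup>2) \<mu> N (\<lambda>i x. complex_of_real (u i x)) m \<xi>"
    by (intro prob_space.discretization_complex orthonormal_complex_of_real) auto
  then show ?case using 4 discretizes_L2_of_complex by blast
next
  case (5 d \<Omega> \<mu> N t u)
  then have "\<exists>m \<xi>. 1 \<le> m \<and> real m \<le> 64800 * t\<^sup>2 * real N \<and> (\<forall>j\<in>{1..m}. \<xi> j \<in> space \<mu>) \<and>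
      discretizes_L2 (1/4) (8 * t\<^sup>2) \<mu> N u m \<xi>"
    by (intro prob_space.discretization_complex) auto
  with 5 show ?case by blast
qed auto

end
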